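(* There is an algorithm (ROMAN $\{2\}$-DOM-IN-BLOCK) which, given a connected block graph $G=(V,E)$ that is not a complete graph, together with its block-cutpoint graph $T_G$ and a tree ordering of $T_G$, outputs the Roman $\{2\}$-domination number $\gamma_{\{R2\}}(G)$ in time $O(n)$, where $n=|V|$.
   Context: For a graph $G=(V,E)$, a Roman $\{2\}$-dominating function (R2DF) is a function $f:V\to\{0,1,2\}$ such that every vertex $v$ with $f(v)=0$ satisfies $\sum_{u\in N(v)} f(u)\ge 2$; its weight is $\sum_{v\in V} f(v)$, and $\gamma_{\{R2\}}(G)$ is the minimum weight of an R2DF of $G$. A cut-vertex is a vertex whose removal increases the number of connected components. A block of $G$ is a maximal connected induced subgraph without a cut-vertex; $G$ is a block graph if every block is a complete graph. For a connected graph $G$, the block-cutpoint graph $T_G$ is the bipartite graph whose vertices are the cut-vertices of $G$ together with one vertex $h_H$ for each block $H$ of $G$, with an edge $v h_H$ exactly when the cut-vertex $v$ lies in $H$; it is a tree. A tree ordering of a tree with $m$ vertices is an ordering $v_1,\dots,v_m$ such that each $v_i$ with $i<m$ has exactly one neighbor $v_j$ with $j>i$. *)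

theory Defs
  imports "Graph_Theory.Graph_Theory"
begin

section \<open>Graphs, blocks and block-cutpoint graphs\<close>

text \<open>
  Undirected simple graphs are the symmetric loop-free digraphs of the locale \<^locale>\<open>graph\<close>
  (or \<^locale>\<open>pair_graph\<close>).  For these, the strongly connected components are the
  connected components.
\<close>

definition cut_vertex :: "('a, 'b) pre_digraph \<Rightarrow> 'a \<Rightarrow> bool" where
  "cut_vertex G v \<longleftrightarrow> v \<in> verts G \<and>
     card (pre_digraph.sccs G) < card (pre_digraph.sccs (pre_digraph.del_vert G v))"

definition connected_without_cut_vertex :: "('a, 'b) pre_digraph \<Rightarrow> bool" where
  "connected_without_cut_vertex H \<longleftrightarrow>
     Digraph_Component.connected H \<and> (\<forall>v. \<not> cut_vertex H v)"

text \<open>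
  A block is an induced subgraph, hence determined by its vertex set; blocks are represented
  by their vertex sets.  The empty set is excluded because \<^const>\<open>Digraph_Component.connected\<close>
  requires a nonempty set of vertices.
\<close>

definition blocks :: "('a, 'b) pre_digraph \<Rightarrow> 'a set set" where
  "blocks G = {S. S \<subseteq> verts G \<and> connected_without_cut_vertex (G \<restriction> S) \<and>
     (\<forall>S'. S \<subset> S' \<and> S' \<subseteq> verts G \<longrightarrow> \<not> connected_without_cut_vertex (G \<restriction> S'))}"

definition complete_graph :: "('a, 'b) pre_digraph \<Rightarrow> bool" where
  "complete_graph G \<longleftrightarrow> complete_digraph (card (verts G)) G"

definition block_graph :: "('a, 'b) pre_digraph \<Rightarrow> bool" where
  "block_graph G \<longleftrightarrow> (\<forall>S \<in> blocks G. complete_graph (G \<restriction> S))"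

definition block_cutpoint_graph :: "('a, 'b) pre_digraph \<Rightarrow> ('a + 'a set) pair_pre_digraph" where
  "block_cutpoint_graph G =
     \<lparr> pverts = Inl ` {v. cut_vertex G v} \<union> Inr ` blocks G,
       parcs = {(Inl v, Inr S) | v S. cut_vertex G v \<and> S \<in> blocks G \<and> v \<in> S} \<union>
               {(Inr S, Inl v) | v S. cut_vertex G v \<and> S \<in> blocks G \<and> v \<in> S} \<rparr>"

definition tree_ordering :: "'a pair_pre_digraph \<Rightarrow> 'a list \<Rightarrow> bool" where
  "tree_ordering T xs \<longleftrightarrow> distinct xs \<and> set xs = pverts T \<and>
     (\<forall>i. Suc i < length xs \<longrightarrow>
        (\<exists>!j. i < j \<and> j < length xs \<and> (xs ! i, xs ! j) \<in> parcs T))"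


section \<open>Roman $\{2\}$-domination\<close>

definition roman2_dominating :: "('a, 'b) pre_digraph \<Rightarrow> ('a \<Rightarrow> nat) \<Rightarrow> bool" where
  "roman2_dominating G f \<longleftrightarrow> f ` verts G \<subseteq> {0, 1, 2} \<and>
     (\<forall>v \<in> verts G. f v = 0 \<longrightarrow> (\<Sum>u | v \<rightarrow>\<^bsub>G\<^esub> u. f u) \<ge> 2)"

definition roman2_domination_number :: "('a, 'b) pre_digraph \<Rightarrow> nat" where
  "roman2_domination_number G =
     (LEAST w. \<exists>f. roman2_dominating G f \<and> (\<Sum>v \<in> verts G. f v) = w)"


section \<open>A random access machine with logarithmic word length\<close>

text \<open>
  Programs work on natural-number registers and on arrays of natural numbers; every program
  mentions only finitely many registers and arrays, by constant names, whereas array indices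
  are computed.  Every elementary instruction and every evaluation of a test costs one unit of
  time.  An instruction whose index or result exceeds the bound \<open>W\<close> on machine words has
  no transition, so that unit cost cannot be exploited by computing with huge numbers.
\<close>

datatype operand = Const nat | Reg nat

datatype test = Less operand operand | Equal operand operand

datatype prog =
    Skip
  | Move nat operand
  | Add nat operand operand
  | Sub nat operand operand
  | Load nat nat operand
  | Store nat operand operand
  | Seq prog prog
  | Cond test prog prog
  | While test prog

type_synonym machine_state = "(nat \<Rightarrow> nat) \<times> (nat \<Rightarrow> nat \<Rightarrow> nat)"

fun operand_val :: "(nat \<Rightarrow> nat) \<Rightarrow> operand \<Rightarrow> nat" where
  "operand_val r (Const k) = k"
| "operand_val r (Reg x) = r x"

fun test_val :: "(nat \<Rightarrow> nat) \<Rightarrow> test \<Rightarrow> bool" where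
  "test_val r (Less a b) \<longleftrightarrow> operand_val r a < operand_val r b"
| "test_val r (Equal a b) \<longleftrightarrow> operand_val r a = operand_val r b"

text \<open>
  \<open>exec W P s t s'\<close>: started in state \<open>s\<close>, the program \<open>P\<close> halts in state \<open>s'\<close> after
  exactly \<open>t\<close> steps, all computed words being at most \<open>W\<close>.
\<close>

inductive exec :: "nat \<Rightarrow> prog \<Rightarrow> machine_state \<Rightarrow> nat \<Rightarrow> machine_state \<Rightarrow> bool"
  for W :: nat where
  Skip: "exec W Skip s 1 s"
| Move: "operand_val r a \<le> W \<Longrightarrow>
    exec W (Move x a) (r, m) 1 (r(x := operand_val r a), m)"
| Add: "operand_val r a + operand_val r b \<le> W \<Longrightarrow>
    exec W (Add x a b) (r, m) 1 (r(x := operand_val r a + operand_val r b), m)"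
| Sub: "operand_val r a - operand_val r b \<le> W \<Longrightarrow>
    exec W (Sub x a b) (r, m) 1 (r(x := operand_val r a - operand_val r b), m)"
| Load: "operand_val r i \<le> W \<Longrightarrow> m A (operand_val r i) \<le> W \<Longrightarrow>
    exec W (Load x A i) (r, m) 1 (r(x := m A (operand_val r i)), m)"
| Store: "operand_val r i \<le> W \<Longrightarrow> operand_val r a \<le> W \<Longrightarrow>
    exec W (Store A i a) (r, m) 1
      (r, m(A := (m A)(operand_val r i := operand_val r a)))"
| Seq: "exec W P s t s' \<Longrightarrow> exec W Q s' u s'' \<Longrightarrow> exec W (Seq P Q) s (t + u) s''"
| Cond_True: "test_val (fst s) b \<Longrightarrow> exec W P s t s' \<Longrightarrow>
    exec W (Cond b P Q) s (1 + t) s'"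
| Cond_False: "\<not> test_val (fst s) b \<Longrightarrow> exec W Q s t s' \<Longrightarrow>
    exec W (Cond b P Q) s (1 + t) s'"
| While_False: "\<not> test_val (fst s) b \<Longrightarrow> exec W (While b P) s 1 s"
| While_True: "test_val (fst s) b \<Longrightarrow> exec W P s t s' \<Longrightarrow> exec W (While b P) s' u s'' \<Longrightarrow>
    exec W (While b P) s (1 + t + u) s''"

inductive_cases exec_elims:
  "exec W Skip s t s'" "exec W (Move x a) s t s'" "exec W (Add x a b) s t s'"
  "exec W (Sub x a b) s t s'" "exec W (Load x A i) s t s'" "exec W (Store A i a) s t s'"
  "exec W (Seq P Q) s t s'" "exec W (Cond b P Q) s t s'" "exec W (While b P) s t s'"

lemma exec_deterministic:
  "exec W P s t s' \<Longrightarrow> exec W P s u s'' \<Longrightarrow> u = t \<and> s'' = s'"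
proof (induction arbitrary: u s'' rule: exec.induct)
  case (Seq P s t s1 Q v s2)
  from Seq.prems obtain t' s1' v' where "exec W P s t' s1'" "exec W Q s1' v' s''" "u = t' + v'"
    by (rule exec_elims) metis
  with Seq.IH show ?case by metis
next
  case (Cond_True s b P t s1 Q)
  from Cond_True.prems Cond_True.hyps(1) obtain t' where "exec W P s t' s''" "u = 1 + t'"
    by - (erule exec_elims; auto)
  with Cond_True.IH show ?case by metis
next
  case (Cond_False s b Q t s1 P)
  from Cond_False.prems Cond_False.hyps(1) obtain t' where "exec W Q s t' s''" "u = 1 + t'"
    by - (erule exec_elims; auto)
  with Cond_False.IH show ?case by metis
next
  case (While_False s b P)
  from While_False.prems While_False.hyps show ?case
    by - (erule exec_elims; auto)
next
  case (While_True s b P t s1 v s2)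
  from While_True.prems While_True.hyps(1) obtain t' s1' v'
    where "exec W P s t' s1'" "exec W (While b P) s1' v' s''" "u = 1 + t' + v'"
    by - (erule exec_elims; auto)
  with While_True.IH show ?case by metis
qed (erule exec_elims; simp)+


section \<open>Representation of the input\<close>

text \<open>
  Adjacency lists of \<open>T\<close>, each in arbitrary order, where the vertex \<open>x\<close> is known to the machine
  as the number \<open>code x < N\<close>.  Numbers that are not the code of a vertex have an empty list.
\<close>

definition adjacency_lists ::
  "'a pair_pre_digraph \<Rightarrow> ('a \<Rightarrow> nat) \<Rightarrow> nat \<Rightarrow> nat list list \<Rightarrow> bool" where
  "adjacency_lists T code N L \<longleftrightarrow> length L = N \<and>
     (\<forall>x \<in> pverts T. distinct (L ! code x) \<and>
        set (L ! code x) = code ` {y. (x, y) \<in> parcs T}) \<and>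
     (\<forall>i < N. i \<notin> code ` pverts T \<longrightarrow> L ! i = [])"

text \<open>An enumeration of the blocks, each given by the list of its vertices.\<close>

definition block_lists :: "('a, 'b) pre_digraph \<Rightarrow> 'a list list \<Rightarrow> bool" where
  "block_lists G B \<longleftrightarrow> (\<forall>b \<in> set B. distinct b) \<and> distinct (map set B) \<and>
     set ` set B = blocks G"

text \<open>
  In the block-cutpoint graph of a graph with vertices \<open>0, \<dots>, n - 1\<close>, a cut-vertex keeps its
  number, and the vertex of the block listed at position \<open>i\<close> gets the number \<open>n + i\<close>.
\<close>

fun bc_code :: "nat \<Rightarrow> nat list list \<Rightarrow> nat + nat set \<Rightarrow> nat" where
  "bc_code n B (Inl v) = v"
| "bc_code n B (Inr S) = n + (THE i. i < length B \<and> set (B ! i) = S)"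

text \<open>
  A list of rows is stored as the concatenation of the rows and the array of their offsets:
  row \<open>i\<close> occupies the positions from entry \<open>i\<close> up to, but excluding, entry \<open>i + 1\<close>
  of the offset array.
\<close>

definition row_offsets :: "'a list list \<Rightarrow> nat list" where
  "row_offsets L = map (\<lambda>i. length (concat (take i L))) [0..<Suc (length L)]"

definition array_of :: "nat list \<Rightarrow> nat \<Rightarrow> nat" where
  "array_of xs i = (if i < length xs then xs ! i else 0)"

definition initial_state ::
  "nat list list \<Rightarrow> nat list list \<Rightarrow> nat list list \<Rightarrow> nat list \<Rightarrow> machine_state" where
  "initial_state L B T xs =
     (array_of [length L, length B, length xs],
      \<lambda>A. array_of
        (if A < 7
         then [row_offsets L, concat L, row_offsets B, concat B,
               row_offsets T, concat T, xs] ! A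
         else []))"

end

theory Submission
  imports Defs
begin

text \<open>
  A vertex \<open>v\<close> violating the domination condition may be repaired at cost \<open>2\<close>, so the Roman
  \<open>{2}\<close>-domination number is the minimum, over all functions \<open>f\<close> with values in \<open>{0, 1, 2}\<close>, of the
  weight of \<open>f\<close> plus \<open>2\<close> for each violating vertex.  In a block graph the value received by \<open>v\<close>
  is the sum over the blocks containing \<open>v\<close>.  Hence a block that meets the others in at most one
  vertex \<open>p\<close> can be eliminated: minimising over the values of its other vertices only
  changes the cost that is attached to \<open>p\<close>, as a function of the value of \<open>p\<close> and of what
  \<open>p\<close> receives from the other blocks.  A tree ordering of the block-cutpoint graph provides such a
  block in each step, and eliminating a block takes time linear in its size.
\<close>

section \<open>Blocks of block graphs\<close>

text \<open>With penalties every function is admissible, so all table entries are finite and no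
  infeasible states arise. Two facts keep the tables at five entries. A vertex of value 0 adds
  nothing to the total of its own block, so all zeros of a block receive the same sum from it,
  namely that total; for a positive vertex the received sum is irrelevant. And a received sum
  matters only up to 2, so it suffices to demand that the deleted vertices have total at least j,
  for j = 0, 1, 2. Such a one-sided demand is sound only if costs do not increase with the received
  sum. This, and the fact that changing any state of a vertex to value 2 costs at most 2 more, is
  the invariant \<open>regular\<close>.

  The time is linear in n, although the graph may have quadratically many edges, because a block is
  scanned as a list of vertices and each elimination deletes all but one of at least two vertices;
  hence all rows together have at most 2 * n entries. Words stay small because the largest entries
  of the remaining vertices, summed up, never exceed their initial total 2 * n.\<close>

definition joined :: "('a \<times> 'a) set \<Rightarrow> 'a set \<Rightarrow> bool" where
  "joined E S \<longleftrightarrow> (\<forall>x\<in>S. \<forall>y\<in>S. (x, y) \<in> rtrancl_on S E)"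

lemma joinedI_anchor:
  assumes "sym E" "\<And>x. x \<in> S \<Longrightarrow> (x, a) \<in> rtrancl_on S E"
  shows "joined E S"
  unfolding joined_def
  by (metis assms rtrancl_on_sym rtrancl_on_trans symE)

lemma rtrancl_on_edge: "(x, y) \<in> E \<Longrightarrow> x \<in> S \<Longrightarrow> y \<in> S \<Longrightarrow> (x, y) \<in> rtrancl_on S E"
  by (meson rtrancl_on.intros)

lemma rtrancl_on_Int_Times: "rtrancl_on S (E \<inter> S \<times> S) = rtrancl_on S E"
proof (intro equalityI subrelI)
  fix x y assume "(x, y) \<in> rtrancl_on S E"
  then show "(x, y) \<in> rtrancl_on S (E \<inter> S \<times> S)"
    by induct (auto intro: converse_rtrancl_on_into_rtrancl_on)
qed (meson Int_lower1 order_refl rtrancl_on_mono)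

lemma rtrancl_on_clique:
  assumes "\<And>x y. x \<in> S \<Longrightarrow> y \<in> S \<Longrightarrow> x \<noteq> y \<Longrightarrow> (x, y) \<in> E" "S \<subseteq> W" "x \<in> S" "y \<in> S"
  shows "(x, y) \<in> rtrancl_on W E"
  using assms by (cases "x = y") (auto intro: rtrancl_on_edge rtrancl_on.intros)

lemma rtrancl_on_distinct_path:
  assumes "(x, y) \<in> rtrancl_on S E"
  shows "\<exists>p. p \<noteq> [] \<and> hd p = x \<and> last p = y \<and> distinct p \<and> set p \<subseteq> S \<and>
    successively (\<lambda>u v. (u, v) \<in> E) p"
  using assms
proof (induct rule: rtrancl_on_induct)
  case base
  then show ?case by (intro exI[of _ "[x]"]) auto
next
  case (step y z)
  then obtain p where p: "p \<noteq> []" "hd p = x" "last p = y" "distinct p" "set p \<subseteq> S"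
    "successively (\<lambda>u v. (u, v) \<in> E) p" by auto
  show ?case
  proof (cases "z \<in> set p")
    case True
    \<comment> \<open>The walk returns to \<open>z\<close>: the prefix up to that occurrence is
      already a path to \<open>z\<close>.\<close>
    then obtain q r where "p = q @ z # r" by (meson split_list)
    with p show ?thesis
      by (intro exI[of _ "q @ [z]"]) (auto simp: successively_append_iff hd_append split: if_splits)
  next
    case False
    with p step show ?thesis
      by (intro exI[of _ "p @ [z]"]) (auto simp: successively_append_iff)
  qed
qed

lemma rtrancl_on_hd_path:
  assumes "successively (\<lambda>u v. (u, v) \<in> E) p" "set p \<subseteq> S" "p \<noteq> []" "x \<in> set p"
  shows "(hd p, x) \<in> rtrancl_on S E"
  using assms
proof (induct p)
  case (Cons u p)
  show ?case
  proof (cases "p = []")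
    case False
    with Cons show ?thesis
      by (auto simp: successively_Cons intro: rtrancl_on.intros converse_rtrancl_on_into_rtrancl_on)
  qed (use Cons in \<open>auto intro: rtrancl_on.intros\<close>)
qed simp

lemma rtrancl_on_path_last:
  assumes "successively (\<lambda>u v. (u, v) \<in> E) p" "set p \<subseteq> S" "p \<noteq> []" "x \<in> set p"
  shows "(x, last p) \<in> rtrancl_on S E"
  using assms
proof (induct p arbitrary: x)
  case (Cons u p)
  show ?case
  proof (cases "p = []")
    case False
    then have "(y, last p) \<in> rtrancl_on S E" if "y \<in> set p" for y
      using Cons.hyps[of y] Cons.prems(1,2) that by (simp add: successively_Cons)
    moreover have "(u, hd p) \<in> E" "hd p \<in> set p"
      using Cons.prems(1) False by (auto simp: successively_Cons)
    ultimately show ?thesis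
      using Cons.prems(2,4) by (auto intro: converse_rtrancl_on_into_rtrancl_on)
  qed (use Cons in \<open>auto intro: rtrancl_on.intros\<close>)
qed simp

text \<open>The cliques are held together twice, by \<open>v\<close> and by a path that avoids
  \<open>v\<close>. Deleting a single vertex \<open>w\<close> breaks at most one of the two
  links.\<close>

lemma joined_two_cliques_path:
  assumes E: "sym E"
    and S: "\<And>x y. x \<in> S \<Longrightarrow> y \<in> S \<Longrightarrow> x \<noteq> y \<Longrightarrow> (x, y) \<in> E"
    and T: "\<And>x y. x \<in> T \<Longrightarrow> y \<in> T \<Longrightarrow> x \<noteq> y \<Longrightarrow> (x, y) \<in> E"
    and v: "v \<in> S" "v \<in> T"
    and p: "p \<noteq> []" "hd p \<in> S" "last p \<in> T" "v \<notin> set p" "distinct p"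
      "successively (\<lambda>u v. (u, v) \<in> E) p"
  shows "joined E (S \<union> T \<union> set p - {w})"
proof -
  let ?W = "S \<union> T \<union> set p - {w}"
  have symW: "sym (rtrancl_on ?W E)" by (rule rtrancl_on_sym[OF E])
  have S': "(x, y) \<in> rtrancl_on ?W E" if "x \<in> S" "y \<in> S" "x \<noteq> w" "y \<noteq> w" for x y
    by (rule rtrancl_on_clique[of "S - {w}"]) (use S that in auto)
  have T': "(x, y) \<in> rtrancl_on ?W E" if "x \<in> T" "y \<in> T" "x \<noteq> w" "y \<noteq> w" for x y
    by (rule rtrancl_on_clique[of "T - {w}"]) (use T that in auto)
  have hd: "(x, hd q) \<in> rtrancl_on ?W E"
    if "successively (\<lambda>u v. (u, v) \<in> E) q" "set q \<subseteq> set p - {w}" "x \<in> set q" for q x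
    using rtrancl_on_hd_path[OF that(1), of ?W x] that symW by (fastforce dest: symD)
  have last: "(x, last q) \<in> rtrancl_on ?W E"
    if "successively (\<lambda>u v. (u, v) \<in> E) q" "set q \<subseteq> set p - {w}" "x \<in> set q" for q x
    using rtrancl_on_path_last[OF that(1), of ?W x] that by fastforce
  show ?thesis
  proof (cases "w \<in> set p")
    \<comment> \<open>The path survives whole and links the cliques, even if
      \<open>w = v\<close>.\<close>
    case False
    show ?thesis
    proof (rule joinedI_anchor[OF E, of _ "hd p"])
      fix x assume x: "x \<in> ?W"
      have neq: "hd p \<noteq> w" "last p \<noteq> w" using False p by auto
      have p': "(y, hd p) \<in> rtrancl_on ?W E" if "y \<in> set p" for y
        by (rule hd) (use that p False in auto)
      consider "x \<in> S" | "x \<in> T" | "x \<in> set p" using x by blast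
      then show "(x, hd p) \<in> rtrancl_on ?W E"
      proof cases
        case 1
        then show ?thesis using S' x neq p by simp
      next
        case 2
        then have "(x, last p) \<in> rtrancl_on ?W E" using T' x neq p by simp
        then show ?thesis using p' p rtrancl_on_trans by (metis last_in_set)
      qed (rule p')
    qed
  next
    case True
    \<comment> \<open>Each part of the broken path still reaches the clique at its outer end, and
      both cliques contain \<open>v\<close>, which differs from \<open>w\<close>.\<close>
    then obtain q r where qr: "p = q @ w # r" by (meson split_list)
    have vw: "v \<noteq> w" using True p by auto
    have q: "(x, v) \<in> rtrancl_on ?W E" if "x \<in> set q" for x
    proof -
      have "hd q = hd p" using qr that by (cases q) auto
      moreover have "hd q \<noteq> w" using p qr that by (cases q) auto
      moreover have "(x, hd q) \<in> rtrancl_on ?W E"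
        by (rule hd) (use p qr that in \<open>auto simp: successively_append_iff\<close>)
      ultimately show ?thesis
        using rtrancl_on_trans[OF _ S'[of "hd q" v]] p v vw by simp
    qed
    have r: "(x, v) \<in> rtrancl_on ?W E" if "x \<in> set r" for x
    proof -
      have "last r = last p" using qr that by (cases r) auto
      moreover have "last r \<noteq> w" using p qr that by (cases r rule: rev_cases) auto
      moreover have "(x, last r) \<in> rtrancl_on ?W E"
        by (rule last) (use p qr that in \<open>auto simp: successively_append_iff successively_Cons\<close>)
      ultimately show ?thesis
        using rtrancl_on_trans[OF _ T'[of "last r" v]] p v vw by simp
    qed
    show ?thesis
    proof (rule joinedI_anchor[OF E, of _ v])
      fix x assume "x \<in> ?W"
      then consider "x \<in> S" "x \<noteq> w" | "x \<in> T" "x \<noteq> w" | "x \<in> set q" | "x \<in> set r"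
        using qr by auto
      then show "(x, v) \<in> rtrancl_on ?W E"
        by cases (use q r S' T' v vw in simp_all)
    qed
  qed
qed

lemma joined_Un:
  assumes "sym E" "joined E S" "joined E T" "a \<in> S" "a \<in> T"
  shows "joined E (S \<union> T)"
proof (rule joinedI_anchor[OF assms(1)])
  fix x assume "x \<in> S \<union> T"
  then show "(x, a) \<in> rtrancl_on (S \<union> T) E"
    using assms(2-) unfolding joined_def
    by (metis Un_iff Un_upper1 Un_upper2 order_refl rtrancl_on_mono)
qed

lemma joined_path:
  assumes "sym E" "successively (\<lambda>u v. (u, v) \<in> E) p"
  shows "joined E (set p)"
proof (cases "p = []")
  case False
  show ?thesis
    by (rule joinedI_anchor[OF assms(1), of _ "last p"], rule rtrancl_on_path_last)
      (use False assms in auto)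
qed (simp add: joined_def)

lemma joined_clique:
  assumes "\<And>x y. x \<in> S \<Longrightarrow> y \<in> S \<Longrightarrow> x \<noteq> y \<Longrightarrow> (x, y) \<in> E"
  shows "joined E S"
  using rtrancl_on_clique[of S E S] assms by (auto simp: joined_def)

section \<open>Components and cut-vertices of induced subgraphs\<close>

lemma arcs_ends_induce: "arcs_ends (G \<restriction> S) = arcs_ends G \<inter> S \<times> S"
  by (auto simp: arcs_ends_conv)

lemma del_vert_induce: "pre_digraph.del_vert (G \<restriction> S) v = G \<restriction> (S - {v})"
  by (auto simp: pre_digraph.del_vert_def induce_subgraph_def)

lemma (in wf_digraph) induce_verts: "G \<restriction> verts G = G"
  by (auto simp: induce_subgraph_def intro: pre_digraph.equality)

lemma (in graph) graph_induce:
  assumes "S \<subseteq> verts G"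
  shows "graph (G \<restriction> S)"
proof -
  have "digraph (G \<restriction> S)" "sym_digraph (G \<restriction> S)"
    using assms by (auto intro: digraphI_induced induced_graph_imp_graph)
  then show ?thesis by (simp add: graph_def pseudo_graph_def digraph_def)
qed

lemma (in graph) card_sccs_le_1:
  "card sccs \<le> 1 \<longleftrightarrow> (\<forall>x\<in>verts G. \<forall>y\<in>verts G. x \<rightarrow>\<^sup>* y)"
proof -
  have "card sccs = card (scc_of ` verts G)"
    by (simp add: card_sccs_verts[symmetric] sccs_verts_conv_scc_of)
  also have "\<dots> \<le> 1 \<longleftrightarrow> (\<forall>x\<in>verts G. \<forall>y\<in>verts G. scc_of x = scc_of y)"
    by (subst One_nat_def, subst card_le_Suc0_iff_eq) auto
  also have "\<dots> \<longleftrightarrow> (\<forall>x\<in>verts G. \<forall>y\<in>verts G. x \<rightarrow>\<^sup>* y)"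
    by (metis in_scc_of_self scc_ofI_reachable scc_of_eq mem_Collect_eq scc_of_def)
  finally show ?thesis .
qed

lemma (in graph) card_sccs_pos:
  assumes "verts G \<noteq> {}"
  shows "0 < card sccs"
proof -
  have "scc_of ` verts G \<noteq> {}" using assms by simp
  then show ?thesis
    by (simp add: card_sccs_verts[symmetric] sccs_verts_conv_scc_of card_gt_0_iff)
qed

context graph
begin

abbreviation "E \<equiv> arcs_ends G"

lemma sym_E: "sym E"
  using sym_arcs by (simp add: symmetric_def)

text \<open>At most one, not exactly one: the empty set is joined and has no component, which covers
  the deletion of the only vertex of a singleton.\<close>

lemma card_sccs_induce_le_1:
  assumes "S \<subseteq> verts G"
  shows "card (pre_digraph.sccs (G \<restriction> S)) \<le> 1 \<longleftrightarrow> joined E S"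
proof -
  interpret H: graph "G \<restriction> S" by (rule graph_induce[OF assms])
  show ?thesis
    by (simp add: H.card_sccs_le_1[unfolded One_nat_def] joined_def reachable_def arcs_ends_induce rtrancl_on_Int_Times)
qed

lemma connected_induce:
  assumes "S \<subseteq> verts G"
  shows "Digraph_Component.connected (G \<restriction> S) \<longleftrightarrow> S \<noteq> {} \<and> joined E S"
proof -
  interpret H: graph "G \<restriction> S" by (rule graph_induce[OF assms])
  have "((E \<inter> S \<times> S)\<^sup>s) = E \<inter> S \<times> S"
    using sym_E by (auto simp: symcl_def sym_def)
  then show ?thesis
    by (simp add: connected_conv joined_def arcs_ends_induce rtrancl_on_Int_Times)
qed

text \<open>A nonempty joined set has exactly one component, so deleting \<open>v\<close> increases
  the number exactly if at least two are left.\<close>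

lemma cut_vertex_induce:
  assumes "S \<subseteq> verts G" "joined E S" "v \<in> S"
  shows "cut_vertex (G \<restriction> S) v \<longleftrightarrow> \<not> joined E (S - {v})"
proof -
  interpret H: graph "G \<restriction> S" by (rule graph_induce[OF assms(1)])
  have "card H.sccs \<le> 1" using card_sccs_induce_le_1 assms by blast
  moreover have "0 < card H.sccs" using H.card_sccs_pos assms by auto
  moreover have "card (pre_digraph.sccs (G \<restriction> (S - {v}))) \<le> 1 \<longleftrightarrow> joined E (S - {v})"
    using assms by (intro card_sccs_induce_le_1) auto
  ultimately show ?thesis using assms by (auto simp: cut_vertex_def del_vert_induce)
qed

lemma connected_without_cut_vertex_induce:
  assumes "S \<subseteq> verts G"
  shows "connected_without_cut_vertex (G \<restriction> S) \<longleftrightarrow>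
    S \<noteq> {} \<and> joined E S \<and> (\<forall>v. joined E (S - {v}))"
proof -
  have "\<not> cut_vertex (G \<restriction> S) v" if "v \<notin> S" for v
    using that by (simp add: cut_vertex_def)
  moreover have "S - {v} = S" if "v \<notin> S" for v
    using that by auto
  ultimately show ?thesis
    using assms connected_induce cut_vertex_induce
    unfolding connected_without_cut_vertex_def by metis
qed

section \<open>Blocks as maximal biconnected sets\<close>

definition biconnected :: "'a set \<Rightarrow> bool" where
  "biconnected S \<longleftrightarrow> S \<noteq> {} \<and> joined E S \<and> (\<forall>v. joined E (S - {v}))"

lemma blocks_iff:
  "S \<in> blocks G \<longleftrightarrow> S \<subseteq> verts G \<and> biconnected S \<and>
     (\<forall>S'. S \<subset> S' \<and> S' \<subseteq> verts G \<longrightarrow> \<not> biconnected S')"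
  using connected_without_cut_vertex_induce unfolding blocks_def biconnected_def
  by (smt (verit) mem_Collect_eq)

text \<open>One-vertex sets and adjacent pairs qualify, so every vertex and every edge lies in a
  block.\<close>

lemma biconnected_clique:
  assumes "S \<noteq> {}" "\<And>x y. x \<in> S \<Longrightarrow> y \<in> S \<Longrightarrow> x \<noteq> y \<Longrightarrow> (x, y) \<in> E"
  shows "biconnected S"
  using assms by (auto simp: biconnected_def intro!: joined_clique)

lemma exists_block:
  assumes "S \<subseteq> verts G" "biconnected S"
  shows "\<exists>T\<in>blocks G. S \<subseteq> T"
proof -
  let ?A = "{T. T \<subseteq> verts G \<and> biconnected T}"
  have "finite ?A" by (rule finite_subset[of _ "Pow (verts G)"]) auto
  then obtain T where "T \<in> ?A" "S \<subseteq> T" "\<forall>T'\<in>?A. T \<subseteq> T' \<longrightarrow> T = T'"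
    using finite_has_maximal2[of ?A S] assms by auto
  then have "T \<in> blocks G" unfolding blocks_iff by blast
  with \<open>S \<subseteq> T\<close> show ?thesis by blast
qed

lemma vertex_in_block:
  assumes "v \<in> verts G"
  shows "\<exists>S\<in>blocks G. v \<in> S"
  using exists_block[of "{v}"] biconnected_clique[of "{v}"] assms by auto

lemma edge_in_block:
  assumes "(u, v) \<in> E"
  shows "\<exists>S\<in>blocks G. u \<in> S \<and> v \<in> S"
proof -
  have "{u, v} \<subseteq> verts G" using assms adj_in_verts by auto
  moreover have "biconnected {u, v}"
    using assms sym_E by (intro biconnected_clique) (auto dest: symD)
  ultimately show ?thesis using exists_block[of "{u, v}"] by auto
qed

lemma block_clique:
  assumes "block_graph G" "S \<in> blocks G" "x \<in> S" "y \<in> S" "x \<noteq> y"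
  shows "(x, y) \<in> E"
proof -
  have "arcs_ends (G \<restriction> S) = {(u, v). (u, v) \<in> S \<times> S \<and> u \<noteq> v}"
    using assms by (auto simp: block_graph_def complete_graph_def complete_digraph_def)
  then have "E \<inter> S \<times> S = {(u, v). (u, v) \<in> S \<times> S \<and> u \<noteq> v}"
    by (simp only: arcs_ends_induce)
  moreover have "(x, y) \<in> {(u, v). (u, v) \<in> S \<times> S \<and> u \<noteq> v}"
    using assms(3-) by simp
  ultimately show ?thesis by blast
qed

lemma block_graph_edge_iff:
  assumes "block_graph G"
  shows "(u, v) \<in> E \<longleftrightarrow> u \<noteq> v \<and> (\<exists>S\<in>blocks G. u \<in> S \<and> v \<in> S)"
  using assms edge_in_block block_clique adj_not_same by metis

text \<open>Otherwise a path avoiding \<open>v\<close> would lead from \<open>S\<close> to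
  \<open>T\<close>. By \<open>joined_two_cliques_path\<close>, both blocks together with this path
  would be biconnected, against the maximality of \<open>S\<close>.\<close>

lemma cut_vertex_if_two_blocks:
  assumes "Digraph_Component.connected G" "block_graph G"
    and ST: "S \<in> blocks G" "T \<in> blocks G" "S \<noteq> T" and v: "v \<in> S" "v \<in> T"
  shows "cut_vertex G v"
proof (rule ccontr)
  assume not_cut: "\<not> cut_vertex G v"
  have "joined E (verts G)"
    using assms(1) connected_induce[of "verts G"] by (simp add: induce_verts)
  moreover have "v \<in> verts G" using ST v by (auto simp: blocks_iff)
  ultimately have joined: "joined E (verts G - {v})"
    using cut_vertex_induce[of "verts G" v] not_cut by (simp add: induce_verts)
  have "\<not> S \<subset> T" "\<not> T \<subset> S" using ST by (auto simp: blocks_iff)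
  \<comment> \<open>Taking \<open>b\<close> outside \<open>S\<close> makes the union a proper
    superset of \<open>S\<close>.\<close>
  then obtain a b where ab: "a \<in> S" "a \<noteq> v" "b \<in> T" "b \<noteq> v" "b \<notin> S"
    using ST v by blast
  then have "(a, b) \<in> rtrancl_on (verts G - {v}) E"
    using joined ST by (auto simp: joined_def blocks_iff)
  from rtrancl_on_distinct_path[OF this] obtain p where p: "p \<noteq> []" "hd p = a" "last p = b"
    "distinct p" "set p \<subseteq> verts G - {v}" "successively (\<lambda>u v. (u, v) \<in> E) p" by blast
  let ?W = "S \<union> T \<union> set p"
  have cliques: "\<And>x y. x \<in> S \<Longrightarrow> y \<in> S \<Longrightarrow> x \<noteq> y \<Longrightarrow> (x, y) \<in> E"
    "\<And>x y. x \<in> T \<Longrightarrow> y \<in> T \<Longrightarrow> x \<noteq> y \<Longrightarrow> (x, y) \<in> E"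
    using block_clique assms by auto
  have "joined E ?W"
    using p ab v
    by (intro joined_Un[OF sym_E, of _ _ b] joined_Un[OF sym_E, of _ _ v]
        joined_path[OF sym_E] joined_clique) (auto intro: cliques)
  moreover have "joined E (?W - {w})" for w
    by (rule joined_two_cliques_path[OF sym_E _ _ v]) (use p ab cliques in auto)
  ultimately have "biconnected ?W" using v by (auto simp: biconnected_def)
  moreover have "S \<subset> ?W" "?W \<subseteq> verts G" using ab p ST by (auto simp: blocks_iff)
  ultimately show False using ST(1) by (auto simp: blocks_iff)
qed

text \<open>By connectedness \<open>v\<close> has a neighbour, and the edge to it lies in a block
  properly containing \<open>{v}\<close>. Hence every elimination deletes at least one
  vertex.\<close>

lemma block_not_singleton:
  assumes "Digraph_Component.connected G" "2 \<le> card (verts G)" "S \<in> blocks G"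
  shows "S \<noteq> {v}"
proof
  assume S: "S = {v}"
  then have "v \<in> verts G" using assms(3) by (auto simp: blocks_iff)
  moreover have "\<not> verts G \<subseteq> {v}"
    using card_mono[of "{v}" "verts G"] assms(2) by auto
  then obtain w where "w \<in> verts G" "w \<noteq> v" by blast
  ultimately have "(v, w) \<in> rtrancl_on (verts G) E"
    using assms(1) connected_induce[of "verts G"] by (simp add: induce_verts joined_def)
  then obtain u where "(v, u) \<in> E" using \<open>w \<noteq> v\<close>
    by (metis converse_rtrancl_on_cases)
  moreover from this have "u \<noteq> v" using adj_not_same by blast
  moreover obtain T where "T \<in> blocks G" "v \<in> T" "u \<in> T"
    using edge_in_block[OF calculation(1)] by blast
  ultimately show False using assms(3) S by (auto simp: blocks_iff)
qed

end

section \<open>Eliminating the blocks one by one\<close>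

text \<open>
  A cost table \<open>\<phi>\<close> assigns to a vertex \<open>v\<close> with value \<open>a\<close> that receives the sum \<open>r\<close> from the
  blocks not yet eliminated the cost \<open>\<phi> v (key a r)\<close> of \<open>v\<close> and of everything below it.  As \<open>r\<close>
  is relevant only if \<open>a = 0\<close>, and only up to \<open>2\<close>, there are five entries.
\<close>

definition key :: "nat \<Rightarrow> nat \<Rightarrow> nat" where
  "key a r = (if a = 0 then min r 2 else a + 2)"

text \<open>
  \<open>dp \<phi> s us j\<close> is the least cost of an assignment to \<open>us\<close> in which all zeros receive \<open>s\<close>
  from the block, where a total value below \<open>j\<close> costs a penalty of \<open>2\<close>.
\<close>

fun dp :: "('a \<Rightarrow> nat \<Rightarrow> nat) \<Rightarrow> nat \<Rightarrow> 'a list \<Rightarrow> nat \<Rightarrow> nat" where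
  "dp \<phi> s [] j = (if j = 0 then 0 else 2)"
| "dp \<phi> s (u # us) j = min (\<phi> u (key 0 s) + dp \<phi> s us j)
     (min (\<phi> u 3 + dp \<phi> s us (j - 1)) (\<phi> u 4 + dp \<phi> s us (j - 2)))"

text \<open>For \<open>q = key a r\<close> the arguments are \<open>q - 2 = a\<close> and, if \<open>a = 0\<close>, \<open>q = min r 2\<close>.\<close>

definition newval :: "('a \<Rightarrow> nat \<Rightarrow> nat) \<Rightarrow> 'a \<Rightarrow> 'a list \<Rightarrow> nat \<Rightarrow> nat" where
  "newval \<phi> p us q =
     (let c = \<lambda>j. \<phi> p (key (q - 2) (q + j)) + dp \<phi> (q - 2 + j) us j
      in min (c 0) (min (c 1) (c 2)))"

text \<open>The shape of costs that eliminations preserve. Entries 0, 1, 2 belong to value 0: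
  receiving more is never dearer. Entry 4 belongs to value 2: switching to it from any state costs
  at most 2 more, the amount of a penalty.\<close>

definition regular :: "(nat \<Rightarrow> nat) \<Rightarrow> bool" where
  "regular c \<longleftrightarrow> c 1 \<le> c 0 \<and> c 2 \<le> c 1 \<and> (\<forall>q\<le>4. c 4 \<le> c q + 2)"

definition block_of :: "'a \<times> 'a list \<Rightarrow> 'a set" where
  "block_of b = insert (fst b) (set (snd b))"

text \<open>Contributions are added block by block, which suits the elimination. By
  \<open>received_eq_sum\<close> no neighbour is counted twice along an elimination order.\<close>

definition received :: "('a \<times> 'a list) list \<Rightarrow> ('a \<Rightarrow> nat) \<Rightarrow> 'a \<Rightarrow> nat" where
  "received es f v = (\<Sum>b\<leftarrow>es. if v \<in> block_of b then sum f (block_of b - {v}) else 0)"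

definition total :: "'a set \<Rightarrow> ('a \<times> 'a list) list \<Rightarrow> ('a \<Rightarrow> nat \<Rightarrow> nat) \<Rightarrow> ('a \<Rightarrow> nat) \<Rightarrow> nat" where
  "total U es \<phi> f = (\<Sum>v\<in>U. \<phi> v (key (f v) (received es f v)))"

definition opt :: "'a set \<Rightarrow> ('a \<times> 'a list) list \<Rightarrow> ('a \<Rightarrow> nat \<Rightarrow> nat) \<Rightarrow> nat" where
  "opt U es \<phi> = (INF f\<in>{f. \<forall>v. f v \<le> 2}. total U es \<phi> f)"

text \<open>The block \<open>(p, us)\<close> is eliminated by deleting \<open>us\<close> and updating the costs of \<open>p\<close>.\<close>

fun elimination :: "'a set \<Rightarrow> 'a \<Rightarrow> ('a \<times> 'a list) list \<Rightarrow> bool" where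
  "elimination U z [] \<longleftrightarrow> U = {z}"
| "elimination U z ((p, us) # es) \<longleftrightarrow>
     p \<in> U - set us \<and> set us \<subseteq> U \<and> us \<noteq> [] \<and> distinct us \<and>
     (\<forall>b\<in>set es. set us \<inter> block_of b = {}) \<and> elimination (U - set us) z es"

fun solve :: "('a \<Rightarrow> nat \<Rightarrow> nat) \<Rightarrow> ('a \<times> 'a list) list \<Rightarrow> 'a \<Rightarrow> nat \<Rightarrow> nat" where
  "solve \<phi> [] = \<phi>"
| "solve \<phi> ((p, us) # es) = solve (\<phi>(p := newval \<phi> p us)) es"

text \<open>Capping \<open>r\<close> at 2 before adding \<open>j\<close> does not change the key, so
  the index alone carries enough information for \<open>newval\<close>.\<close>

lemma newval_key:
  assumes "a \<le> 2"
  shows "newval \<phi> p us (key a r) =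
    min (\<phi> p (key a r) + dp \<phi> a us 0)
      (min (\<phi> p (key a (r + 1)) + dp \<phi> (a + 1) us 1) (\<phi> p (key a (r + 2)) + dp \<phi> (a + 2) us 2))"
proof -
  have "key a r - 2 = a"
    using assms by (auto simp: key_def)
  moreover have "key a (key a r + j) = key a (r + j)" for j
    by (auto simp: key_def min_def)
  note this[of 0] this[of 1] this[of 2]
  ultimately show ?thesis
    by (simp add: newval_def)
qed

lemma key_simps [simp]: "key 0 0 = 0" "key (Suc 0) r = 3" "key 1 r = 3" "key 2 r = 4"
  by (simp_all add: key_def)

lemma key_le: "a \<le> 2 \<Longrightarrow> key a r \<le> 4"
  by (auto simp: key_def)

lemma regular_key_mono:
  assumes "regular c" "r \<le> r'"
  shows "c (key a r') \<le> c (key a r)"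
proof -
  consider "min r' 2 = min r 2" | "min r 2 = 0" "min r' 2 = 1" | "min r 2 = 0" "min r' 2 = 2"
    | "min r 2 = 1" "min r' 2 = 2"
    using assms(2) by linarith
  then have "c (min r' 2) \<le> c (min r 2)"
    using assms(1) by cases (auto simp: regular_def)
  then show ?thesis by (simp add: key_def)
qed

lemma regular_4: "regular c \<Longrightarrow> q \<le> 4 \<Longrightarrow> c 4 \<le> c q + 2"
  by (simp add: regular_def)

lemma regularI_keys:
  assumes "\<And>r r'. r \<le> r' \<Longrightarrow> c (key 0 r') \<le> c (key 0 r)"
    and "\<And>a r. a \<le> 2 \<Longrightarrow> c (key 2 0) \<le> c (key a r) + 2"
  shows "regular c"
proof -
  \<comment> \<open>The index itself serves as received sum: the cap at 2 keeps it if
    \<open>q \<le> 2\<close>, and otherwise \<open>key\<close> ignores it.\<close>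
  have "\<exists>a r. a \<le> 2 \<and> q = key a r" if "q \<le> 4" for q
    using that by (intro exI[of _ "q - 2"] exI[of _ q]) (auto simp: key_def)
  then have "\<forall>q\<le>4. c 4 \<le> c q + 2"
    using assms(2) by (fastforce simp: key_def)
  then show ?thesis
    using assms(1)[of 0 1] assms(1)[of 1 2] by (simp add: regular_def key_def)
qed

section \<open>The dynamic program inside one block\<close>

lemma dp_le:
  assumes "\<And>u. g u \<le> 2" "j \<le> (\<Sum>u\<leftarrow>us. g u)"
  shows "dp \<phi> s us j \<le> (\<Sum>u\<leftarrow>us. \<phi> u (key (g u) s))"
  using assms(2)
proof (induct us arbitrary: j)
  case (Cons u us)
  consider "g u = 0" | "g u = 1" | "g u = 2" using assms(1)[of u] by linarith
  then show ?case
  proof cases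
    case 1
    then show ?thesis using Cons.hyps[of j] Cons.prems by (simp add: min.coboundedI1)
  next
    case 2
    then show ?thesis using Cons.hyps[of "j - 1"] Cons.prems
      by (simp add: min_le_iff_disj)
  next
    case 3
    then show ?thesis using Cons.hyps[of "j - 2"] Cons.prems
      by (simp add: min_le_iff_disj)
  qed
qed simp

text \<open>Following the minimising branch yields the values one after another; the demand left
  over at the end of the list is what triggers the penalty.\<close>

lemma dp_attained:
  assumes "distinct us"
  shows "\<exists>g. (\<forall>u. g u \<le> 2) \<and>
    (\<Sum>u\<leftarrow>us. \<phi> u (key (g u) s)) + (if (\<Sum>u\<leftarrow>us. g u) < j then 2 else 0) \<le> dp \<phi> s us j"
  using assms
proof (induct us arbitrary: j)
  case Nil
  show ?case by (rule exI[of _ "\<lambda>_. 0"]) simp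
next
  case (Cons u us)
  have "\<exists>a\<in>{0, 1, 2}. dp \<phi> s (u # us) j = \<phi> u (key a s) + dp \<phi> s us (j - a)"
    by (simp add: min_def)
  then obtain a where "a \<in> {0, 1, 2}"
    and a': "dp \<phi> s (u # us) j = \<phi> u (key a s) + dp \<phi> s us (j - a)" by blast
  then have a: "a \<le> 2" by auto
  obtain g where g: "\<forall>u. g u \<le> 2"
    "(\<Sum>u\<leftarrow>us. \<phi> u (key (g u) s)) + (if (\<Sum>u\<leftarrow>us. g u) < j - a then 2 else 0)
       \<le> dp \<phi> s us (j - a)"
    using Cons.hyps[of "j - a"] Cons.prems by auto
  \<comment> \<open>As \<open>u\<close> does not occur in \<open>us\<close>, overwriting
    \<open>g\<close> at \<open>u\<close> leaves the sums over \<open>us\<close> unchanged.\<close>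
  define h where "h = g(u := a)"
  have "h u = a" "\<forall>u. h u \<le> 2" using a g(1) by (simp_all add: h_def)
  moreover have "sum_list (map h us) = sum_list (map g us)"
    "(\<Sum>x\<leftarrow>us. \<phi> x (key (h x) s)) = (\<Sum>x\<leftarrow>us. \<phi> x (key (g x) s))"
    using Cons.prems by (auto simp: h_def intro!: arg_cong[of _ _ sum_list])
  ultimately show ?case
    unfolding a' using g(2) by (intro exI[of _ h]) (auto split: if_splits)
qed

text \<open>
  The penalty can be avoided: raising one value to \<open>2\<close> costs no more.
\<close>

lemma dp_attained_regular:
  assumes "distinct us" "us \<noteq> []" "\<And>u. u \<in> set us \<Longrightarrow> regular (\<phi> u)" "j \<le> 2"
  shows "\<exists>g. (\<forall>u. g u \<le> 2) \<and> j \<le> (\<Sum>u\<leftarrow>us. g u) \<and>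
    (\<Sum>u\<leftarrow>us. \<phi> u (key (g u) s)) \<le> dp \<phi> s us j"
proof -
  obtain g where g: "\<forall>u. g u \<le> 2"
    "(\<Sum>u\<leftarrow>us. \<phi> u (key (g u) s)) + (if (\<Sum>u\<leftarrow>us. g u) < j then 2 else 0) \<le> dp \<phi> s us j"
    using dp_attained[OF assms(1)] by blast
  show ?thesis
  proof (cases "(\<Sum>u\<leftarrow>us. g u) < j")
    case False
    with g show ?thesis by (intro exI[of _ g]) auto
  next
    case True
    obtain u ws where us: "us = u # ws" using assms(2) by (cases us) auto
    \<comment> \<open>A single vertex of value 2 meets any demand \<open>j \<le> 2\<close>, and by
      \<open>regular\<close> it costs at most the penalty that is saved.\<close>
    define h where "h = g(u := 2)"
    have "h u = 2" "\<forall>u. h u \<le> 2" using g(1) by (simp_all add: h_def)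
    moreover have "(\<Sum>x\<leftarrow>ws. \<phi> x (key (h x) s)) = (\<Sum>x\<leftarrow>ws. \<phi> x (key (g x) s))"
      using assms(1) us by (auto simp: h_def intro!: arg_cong[of _ _ sum_list])
    moreover have "\<phi> u 4 \<le> \<phi> u (key (g u) s) + 2"
      using assms(3) g(1) us by (intro regular_4 key_le) auto
    ultimately show ?thesis
      using g(2) True assms(4) us by (intro exI[of _ h]) auto
  qed
qed

lemma dp_mono:
  assumes "\<And>u. u \<in> set us \<Longrightarrow> regular (\<phi> u)" "s \<le> s'"
  shows "dp \<phi> s' us j \<le> dp \<phi> s us j"
  using assms(1)
proof (induct us arbitrary: j)
  case (Cons u us)
  have "\<phi> u (key 0 s') \<le> \<phi> u (key 0 s)"
    using Cons.prems assms(2) by (intro regular_key_mono) auto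
  moreover have "dp \<phi> s' us i \<le> dp \<phi> s us i" for i
    using Cons by auto
  ultimately show ?case
    unfolding dp.simps by (intro min.mono add_mono order_refl)
qed simp

text \<open>The terms of the two minima are compared for equal \<open>j\<close>. Passing to value 2
  raises the cost of \<open>p\<close> by at most 2, while the zeros in \<open>us\<close> receive at
  least as much, which by \<open>dp_mono\<close> is not dearer.\<close>

lemma regular_newval:
  assumes "regular (\<phi> p)" "\<And>u. u \<in> set us \<Longrightarrow> regular (\<phi> u)"
  shows "regular (newval \<phi> p us)"
proof (rule regularI_keys)
  fix r r' :: nat assume "r \<le> r'"
  then show "newval \<phi> p us (key 0 r') \<le> newval \<phi> p us (key 0 r)"
    unfolding newval_key[OF zero_le]
    by (intro min.mono add_right_mono regular_key_mono[of "\<phi> p", OF assms(1)]) auto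
next
  fix a r :: nat assume "a \<le> 2"
  have *: "\<phi> p (key 2 i) \<le> \<phi> p (key a k) + 2" for i k
    using regular_4[OF assms(1) key_le[OF \<open>a \<le> 2\<close>]] by (simp add: key_def)
  have "dp \<phi> (2 + j) us j \<le> dp \<phi> (a + j) us j" for j
    using assms \<open>a \<le> 2\<close> by (intro dp_mono) auto
  from add_mono[OF *[of 0 r] this[of 0]] add_mono[OF *[of "0+1" "r+1"] this[of 1]]
    add_mono[OF *[of "0+2" "r+2"] this[of 2]]
  show "newval \<phi> p us (key 2 0) \<le> newval \<phi> p us (key a r) + 2"
    unfolding newval_key[OF \<open>a \<le> 2\<close>] newval_key[OF order_refl] by auto
qed

section \<open>The total cost under an elimination\<close>

lemma received_Cons:
  "received (b # es) f v = (if v \<in> block_of b then sum f (block_of b - {v}) else 0) + received es f v"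
  by (simp add: received_def)

lemma received_notin:
  assumes "\<forall>b\<in>set es. v \<notin> block_of b"
  shows "received es f v = 0"
  using assms by (induct es) (auto simp: received_def)

lemma received_cong:
  assumes "\<And>b u. b \<in> set es \<Longrightarrow> u \<in> block_of b \<Longrightarrow> f u = g u"
  shows "received es f v = received es g v"
  unfolding received_def using assms
  by (intro arg_cong[of _ _ sum_list] map_cong refl) (auto intro: sum.cong)

lemma finite_block_of [simp]: "finite (block_of b)"
  by (simp add: block_of_def)

text \<open>The block separates from the rest because no vertex of \<open>us\<close> occurs in a
  later block: \<open>us\<close> receives only from this block, and the others notice the block only
  through \<open>p\<close>.\<close>

lemma total_Cons:
  assumes "finite U" "elimination U z ((p, us) # es)"
  shows "total U ((p, us) # es) \<phi> f =
    (\<Sum>v\<in>U - set us - {p}. \<phi> v (key (f v) (received es f v))) +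
    (\<phi> p (key (f p) (received es f p + sum_list (map f us))) +
     (\<Sum>u\<leftarrow>us. \<phi> u (key (f u) (f p + sum_list (map f us)))))"
proof -
  let ?c = "\<lambda>v. \<phi> v (key (f v) (received ((p, us) # es) f v))"
  have el: "p \<in> U" "p \<notin> set us" "set us \<subseteq> U" "distinct us"
    "\<forall>b\<in>set es. set us \<inter> block_of b = {}" using assms(2) by auto
  have S: "sum f (set us) = sum_list (map f us)"
    using el by (simp add: sum_list_distinct_conv_sum_set)
  have "?c p = \<phi> p (key (f p) (received es f p + sum_list (map f us)))"
    using el by (simp add: received_Cons block_of_def S add.commute)
  moreover have "(\<Sum>u\<in>set us. ?c u) = (\<Sum>u\<leftarrow>us. \<phi> u (key (f u) (f p + sum_list (map f us))))"
  proof -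
    have "key (f u) (received ((p, us) # es) f u) = key (f u) (f p + sum_list (map f us))"
      if "u \<in> set us" for u
    \<comment> \<open>A zero may count itself without changing the block total, and for a positive
      value \<open>key\<close> ignores the received sum. So the same sum can be charged to all of
      \<open>us\<close>.\<close>
    proof (cases "f u = 0")
      case True
      have "received es f u = 0" using el that by (intro received_notin) auto
      moreover have "sum f (block_of (p, us) - {u}) = sum f (insert p (set us))"
        using True by (intro sum.mono_neutral_left) (auto simp: block_of_def)
      ultimately show ?thesis
        using el that by (simp add: received_Cons block_of_def S)
    qed (simp add: key_def)
    then show ?thesis using el by (simp add: sum_list_distinct_conv_sum_set)
  qed
  moreover have "(\<Sum>v\<in>U - set us - {p}. ?c v) =
      (\<Sum>v\<in>U - set us - {p}. \<phi> v (key (f v) (received es f v)))"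
    by (intro sum.cong) (auto simp: received_Cons block_of_def)
  moreover have "sum ?c U = sum ?c (U - set us - {p}) + (?c p + sum ?c (set us))"
    using assms(1) el by (simp add: sum.subset_diff[of "set us" U] sum.remove[of "U - set us" p])
  ultimately show ?thesis unfolding total_def by simp
qed

lemma total_newval:
  assumes "finite U" "elimination U z ((p, us) # es)"
  shows "total (U - set us) es (\<phi>(p := newval \<phi> p us)) f =
    (\<Sum>v\<in>U - set us - {p}. \<phi> v (key (f v) (received es f v))) +
    newval \<phi> p us (key (f p) (received es f p))"
proof -
  have "p \<in> U - set us" using assms(2) by simp
  then show ?thesis
    using assms(1) by (simp add: total_def sum.remove[of "U - set us" p])
qed

text \<open>For \<open>\<ge>\<close>, a function is kept, and its own total on \<open>us\<close>,
  capped at 2, serves as the demand. For \<open>\<le>\<close>, it is overwritten on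
  \<open>us\<close> by an assignment that attains \<open>dp\<close>; the total may exceed the
  demanded \<open>j\<close>, which \<open>regular\<close> makes harmless.\<close>

lemma opt_elimination:
  assumes "finite U" "elimination U z ((p, us) # es)" "\<And>v. v \<in> U \<Longrightarrow> regular (\<phi> v)"
  shows "opt U ((p, us) # es) \<phi> = opt (U - set us) es (\<phi>(p := newval \<phi> p us))"
proof -
  let ?A = "{f. \<forall>v :: 'a. f v \<le> (2 :: nat)}"
  let ?\<phi> = "\<phi>(p := newval \<phi> p us)"
  have el: "p \<in> U" "p \<notin> set us" "set us \<subseteq> U" "distinct us" "us \<noteq> []"
    "\<forall>b\<in>set es. set us \<inter> block_of b = {}" using assms(2) by auto
  have reg: "regular (\<phi> u)" if "u \<in> set us" for u using assms(3) el that by auto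
  have 1: "total (U - set us) es ?\<phi> f \<le> total U ((p, us) # es) \<phi> f" if "f \<in> ?A" for f
  proof -
    let ?S = "sum_list (map f us)" and ?j = "min 2 (sum_list (map f us))"
    have cap: "key a (r + ?j) = key a (r + ?S)" for a r by (auto simp: key_def)
    have "newval \<phi> p us (key (f p) (received es f p)) \<le>
        \<phi> p (key (f p) (received es f p + ?j)) + dp \<phi> (f p + ?j) us ?j"
    proof -
      consider "?j = 0" | "?j = 1" | "?j = 2" by linarith
      then show ?thesis using that by cases (auto simp: newval_key)
    qed
    also have "dp \<phi> (f p + ?j) us ?j \<le> (\<Sum>u\<leftarrow>us. \<phi> u (key (f u) (f p + ?j)))"
      using that by (intro dp_le) auto
    finally show ?thesis
      by (simp add: total_Cons[OF assms(1,2)] total_newval[OF assms(1,2)] cap)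
  qed
  have 2: "\<exists>g\<in>?A. total U ((p, us) # es) \<phi> g \<le> total (U - set us) es ?\<phi> f" if f: "f \<in> ?A" for f
  proof -
    let ?r = "received es f p"
    have "\<exists>j\<le>2. newval \<phi> p us (key (f p) ?r) = \<phi> p (key (f p) (?r + j)) + dp \<phi> (f p + j) us j"
    proof -
      have "f p \<le> 2" using f by auto
      then show ?thesis unfolding newval_key[OF \<open>f p \<le> 2\<close>] min_def
        by (metis add.right_neutral le_numeral_extra(3) one_le_numeral order_refl zero_le)
    qed
    then obtain j where j: "j \<le> 2"
      "newval \<phi> p us (key (f p) ?r) = \<phi> p (key (f p) (?r + j)) + dp \<phi> (f p + j) us j" by blast
    obtain g where g: "\<forall>u. g u \<le> 2" "j \<le> sum_list (map g us)"
      "(\<Sum>u\<leftarrow>us. \<phi> u (key (g u) (f p + j))) \<le> dp \<phi> (f p + j) us j"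
      using dp_attained_regular[of us \<phi> j "f p + j"] el reg j(1) by blast
    \<comment> \<open>Later blocks do not meet \<open>us\<close>, so what they contribute is the
      same for \<open>h\<close> and \<open>f\<close>.\<close>
    define h where "h = (\<lambda>v. if v \<in> set us then g v else f v)"
    have h: "h p = f p" "map h us = map g us" "h \<in> ?A"
      "\<And>v. v \<in> U - set us - {p} \<Longrightarrow> h v = f v"
      using el f g(1) by (auto simp: h_def)
    have recv: "received es h v = received es f v" for v
      using el by (intro received_cong) (auto simp: h_def)
    have "(\<Sum>u\<leftarrow>us. \<phi> u (key (h u) (f p + sum_list (map g us)))) \<le>
        (\<Sum>u\<leftarrow>us. \<phi> u (key (g u) (f p + j)))"
      using g(2) reg by (intro sum_list_mono) (auto simp: h_def intro!: regular_key_mono)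
    moreover have "\<phi> p (key (f p) (?r + sum_list (map g us))) \<le> \<phi> p (key (f p) (?r + j))"
      using g(2) assms(3) el by (intro regular_key_mono) auto
    moreover have "(\<Sum>v\<in>U - set us - {p}. \<phi> v (key (h v) (received es f v))) =
        (\<Sum>v\<in>U - set us - {p}. \<phi> v (key (f v) (received es f v)))"
      using h(4) by (intro sum.cong) simp_all
    ultimately have "total U ((p, us) # es) \<phi> h \<le> total (U - set us) es ?\<phi> f"
      unfolding total_Cons[OF assms(1,2)] total_newval[OF assms(1,2)] recv h(1,2)
      using g(3) j(2) by linarith
    then show ?thesis using h(3) by blast
  qed
  have ne: "?A \<noteq> {}" by (auto intro: exI[of _ "\<lambda>_. 0"])
  show ?thesis unfolding opt_def
    by (intro antisym cINF_mono ne) (use 1 2 in auto)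
qed

text \<open>When only \<open>z\<close> is left, no block remains from which it could receive
  anything, so only \<open>key a 0\<close> for \<open>a = 0, 1, 2\<close> matters: the entries 0, 3
  and 4.\<close>

lemma opt_solve:
  assumes "finite U" "elimination U z es" "\<And>v. v \<in> U \<Longrightarrow> regular (\<phi> v)"
  shows "opt U es \<phi> = min (solve \<phi> es z 0) (min (solve \<phi> es z 3) (solve \<phi> es z 4))"
  using assms
proof (induct es arbitrary: U \<phi>)
  case Nil
  let ?A = "{f. \<forall>v :: 'a. f v \<le> (2 :: nat)}"
  have total: "total U [] \<phi> f = \<phi> z (key (f z) 0)" for f
    using Nil by (simp add: total_def received_def)
  have "opt U [] \<phi> = Inf ((\<lambda>a. \<phi> z (key a 0)) ` (\<lambda>f. f z) ` ?A)"
    by (simp add: opt_def total image_image)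
  also have "(\<lambda>f. f z) ` ?A = {0, 1, 2}"
  proof (intro equalityI subsetI)
    fix a assume "a \<in> {0, 1, 2 :: nat}"
    then show "a \<in> (\<lambda>f. f z) ` ?A" by (intro image_eqI[of _ _ "\<lambda>_. a"]) auto
  next
    fix a assume "a \<in> (\<lambda>f. f z) ` ?A"
    then have "a \<le> 2" by auto
    then show "a \<in> {0, 1, 2 :: nat}" by (simp, arith)
  qed
  also have "Inf ((\<lambda>a. \<phi> z (key a 0)) ` {0, 1, 2}) =
      min (\<phi> z 0) (min (\<phi> z 3) (\<phi> z 4))"
    by (simp add: cInf_eq_Min)
  finally show ?case by simp
next
  case (Cons b es)
  obtain p us where b: "b = (p, us)" by (cases b)
  have "opt U (b # es) \<phi> = opt (U - set us) es (\<phi>(p := newval \<phi> p us))"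
    unfolding b by (rule opt_elimination[OF Cons.prems[unfolded b]])
  also have "\<dots> = min (solve \<phi> (b # es) z 0) (min (solve \<phi> (b # es) z 3) (solve \<phi> (b # es) z 4))"
    unfolding b solve.simps
  proof (rule Cons.hyps)
    fix v assume v: "v \<in> U - set us"
    show "regular ((\<phi>(p := newval \<phi> p us)) v)"
    proof (cases "v = p")
      case True
      then show ?thesis
        using Cons.prems b v by (auto intro!: regular_newval)
    qed (use Cons.prems v in auto)
  qed (use Cons.prems b in auto)
  finally show ?case .
qed

text \<open>No vertex is deleted twice, and \<open>z\<close> is never deleted, which makes the
  inequality strict.\<close>

lemma elimination_sum_length:
  assumes "finite U" "elimination U z es"
  shows "(\<Sum>b\<leftarrow>es. length (snd b)) < card U"
  using assms
proof (induct es arbitrary: U)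
  case (Cons b es)
  obtain p us where b: "b = (p, us)" by (cases b)
  then have "(\<Sum>b\<leftarrow>es. length (snd b)) < card (U - set us)" using Cons by auto
  moreover have "card (U - set us) = card U - length us"
    using Cons.prems b by (simp add: card_Diff_subset distinct_card)
  ultimately show ?case using b by simp
qed simp

section \<open>Bounds on the table entries\<close>

definition bound :: "('a \<Rightarrow> nat \<Rightarrow> nat) \<Rightarrow> 'a \<Rightarrow> nat" where
  "bound \<phi> v = Max (\<phi> v ` {..4})"

lemma bound_ge: "q \<le> 4 \<Longrightarrow> \<phi> v q \<le> bound \<phi> v"
  by (auto simp: bound_def)

lemma dp_bound: "dp \<phi> s us j \<le> (if j = 0 then 0 else 2) + (\<Sum>u\<leftarrow>us. bound \<phi> u)"
proof (induct us)
  case (Cons u us)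
  then show ?case
    using bound_ge[OF key_le, of 0 \<phi> u s] by (simp add: min_le_iff_disj)
qed simp

text \<open>The term with demand \<open>j = 0\<close> never pays a penalty, so no additive constant
  accumulates over the blocks.\<close>

lemma newval_bound:
  assumes "q \<le> 4"
  shows "newval \<phi> p us q \<le> bound \<phi> p + (\<Sum>u\<leftarrow>us. bound \<phi> u)"
proof -
  have "newval \<phi> p us q \<le> \<phi> p (key (q - 2) q) + dp \<phi> (q - 2) us 0"
    by (simp add: newval_def Let_def)
  also have "\<dots> \<le> bound \<phi> p + (\<Sum>u\<leftarrow>us. bound \<phi> u)"
    using dp_bound[of \<phi> "q - 2" us 0] assms by (intro add_mono bound_ge key_le) auto
  finally show ?thesis .
qed

text \<open>The sum of the bounds is a potential: what \<open>p\<close> can gain, the deleted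
  vertices give up.\<close>

lemma sum_bound_elimination:
  assumes "finite U" "elimination U z ((p, us) # es)"
  shows "sum (bound (\<phi>(p := newval \<phi> p us))) (U - set us) \<le> sum (bound \<phi>) U"
proof -
  have el: "p \<in> U" "p \<notin> set us" "set us \<subseteq> U" "distinct us" using assms(2) by auto
  have "bound (\<phi>(p := newval \<phi> p us)) p \<le> bound \<phi> p + sum (bound \<phi>) (set us)"
    using newval_bound[of _ \<phi> p us] el by (auto simp: bound_def sum_list_distinct_conv_sum_set)
  moreover have "sum (bound (\<phi>(p := newval \<phi> p us))) (U - set us - {p}) =
      sum (bound \<phi>) (U - set us - {p})"
    by (intro sum.cong) (auto simp: bound_def)
  ultimately show ?thesis
    using assms(1) el by (simp add: sum.subset_diff[of "set us" U] sum.remove[of "U - set us" p])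
qed

section \<open>The elimination order given by a tree ordering\<close>

text \<open>
  A block is eliminated towards its unique vertex occurring later in the tree ordering; the last
  item of the ordering may be a block, which then has no such vertex and may choose any.
\<close>

definition pick :: "'a set \<Rightarrow> 'a list \<Rightarrow> 'a" where
  "pick F row = foldl (\<lambda>p v. if v \<in> F then v else p) (hd row) row"

text \<open>The list is reversed because the program scans the row from left to right, and each
  vertex it visits goes to the front of the list for \<open>dp\<close>.\<close>

fun elim_steps :: "nat \<Rightarrow> nat list list \<Rightarrow> nat list \<Rightarrow> (nat \<times> nat list) list" where
  "elim_steps n B [] = []"
| "elim_steps n B (y # ys) =
    (if y < n then elim_steps n B ys
     else let row = B ! (y - n); p = pick (set ys) row
       in (p, rev (filter (\<lambda>v. v \<noteq> p) row)) # elim_steps n B ys)"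

lemma foldl_pick:
  "foldl (\<lambda>p v. if v \<in> F then v else p) p0 row \<in> insert p0 (set row)"
  "set row \<inter> F \<noteq> {} \<Longrightarrow> foldl (\<lambda>p v. if v \<in> F then v else p) p0 row \<in> F"
  by (induct row rule: rev_induct) auto

lemma pick_in_row: "row \<noteq> [] \<Longrightarrow> pick F row \<in> set row"
  using foldl_pick(1)[of F "hd row" row] by (auto simp: pick_def)

lemma pick_in_set: "set row \<inter> F \<noteq> {} \<Longrightarrow> pick F row \<in> F"
  using foldl_pick(2)[of row F] by (auto simp: pick_def)

text \<open>What is kept of a block graph and its tree ordering when only codes are left: items
  below \<open>n\<close> stand for cut-vertices, the item \<open>n + i\<close> for the block
  \<open>B ! i\<close>.\<close>

locale block_order =
  fixes n :: nat and B :: "nat list list" and ys :: "nat list"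
  assumes rows: "i < length B \<Longrightarrow>
      distinct (B ! i) \<and> set (B ! i) \<subseteq> {..<n} \<and> 2 \<le> length (B ! i)"
    and cover: "v < n \<Longrightarrow> \<exists>i<length B. v \<in> set (B ! i)"
    and shared: "i < length B \<Longrightarrow> j < length B \<Longrightarrow> i \<noteq> j \<Longrightarrow>
      v \<in> set (B ! i) \<Longrightarrow> v \<in> set (B ! j) \<Longrightarrow> v \<in> set ys"
    and distinct_ys: "distinct ys"
    and blocks_ys: "{y \<in> set ys. n \<le> y} = {n..<n + length B}"
    and later: "Suc i < length ys \<Longrightarrow> \<exists>!j. i < j \<and> j < length ys \<and>
      (ys ! i < n \<and> n \<le> ys ! j \<and> ys ! i \<in> set (B ! (ys ! j - n)) \<or>
       ys ! j < n \<and> n \<le> ys ! i \<and> ys ! j \<in> set (B ! (ys ! i - n)))"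
    and n_pos: "0 < n"
begin

definition adj :: "nat \<Rightarrow> nat \<Rightarrow> bool" where
  "adj x y \<longleftrightarrow> x < n \<and> n \<le> y \<and> x \<in> set (B ! (y - n)) \<or>
     y < n \<and> n \<le> x \<and> y \<in> set (B ! (x - n))"

text \<open>The vertex that survives all eliminations. If the last item is a block, no item follows
  it, so \<open>pick\<close> is called with the empty set and yields its default, just as in
  \<open>elim_steps\<close>.\<close>

definition last_vertex :: nat where
  "last_vertex = (if last ys < n then last ys else pick {} (B ! (last ys - n)))"

text \<open>Inserting \<open>last_vertex\<close> matters at the end, when no block is left but one
  vertex is.\<close>

definition remaining :: "nat list \<Rightarrow> nat set" where
  "remaining zs = insert last_vertex (\<Union>y\<in>{y \<in> set zs. n \<le> y}. set (B ! (y - n)))"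

lemma row_of:
  assumes "y \<in> set ys" "n \<le> y"
  shows "y - n < length B" "distinct (B ! (y - n))" "set (B ! (y - n)) \<subseteq> {..<n}"
    "2 \<le> length (B ! (y - n))" "B ! (y - n) \<noteq> []"
proof -
  have "y \<in> {n..<n + length B}" using assms blocks_ys by blast
  then show "y - n < length B" by auto
  then show "distinct (B ! (y - n))" "set (B ! (y - n)) \<subseteq> {..<n}"
    "2 \<le> length (B ! (y - n))" "B ! (y - n) \<noteq> []" using rows by fastforce+
qed

lemma ys_nonempty: "ys \<noteq> []"
  using cover[OF n_pos] blocks_ys by auto

lemma later_unique:
  assumes "ys = pre @ y # suf" "suf \<noteq> []"
  shows "\<exists>!w. w \<in> set suf \<and> adj y w"
proof -
  let ?i = "length pre"
  have y: "ys ! ?i = y" and Suc: "Suc ?i < length ys" using assms by auto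
  obtain j where j: "?i < j" "j < length ys" "adj y (ys ! j)"
    and unique: "\<And>k. ?i < k \<Longrightarrow> k < length ys \<Longrightarrow> adj y (ys ! k) \<Longrightarrow> k = j"
    using later[OF Suc] unfolding y adj_def[symmetric] by blast
  have nth: "ys ! (Suc ?i + k) = suf ! k" for k using assms by (simp add: nth_append)
  show ?thesis
  proof (rule ex1I[of _ "ys ! j"])
    have "ys ! j = suf ! (j - Suc ?i)" using nth[of "j - Suc ?i"] j by simp
    moreover have "j - Suc ?i < length suf" using j assms by auto
    ultimately show "ys ! j \<in> set suf \<and> adj y (ys ! j)" using j by auto
  next
    fix w assume "w \<in> set suf \<and> adj y w"
    moreover from this obtain k where "k < length suf" "w = suf ! k" by (auto simp: in_set_conv_nth)
    ultimately show "w = ys ! j" using unique[of "Suc ?i + k"] nth[of k] assms by auto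
  qed
qed

lemma last_vertex_less: "last_vertex < n"
proof (cases "last ys < n")
  case False
  then have "pick {} (B ! (last ys - n)) \<in> set (B ! (last ys - n))"
    using ys_nonempty row_of[of "last ys"] by (intro pick_in_row) auto
  then show ?thesis
    using False ys_nonempty row_of(3)[of "last ys"] by (auto simp: last_vertex_def)
qed (simp add: last_vertex_def)

lemma block_of_elim_steps:
  assumes "set zs \<subseteq> set ys"
  shows "block_of ` set (elim_steps n B zs) = (\<lambda>y. set (B ! (y - n))) ` {y \<in> set zs. n \<le> y}"
  using assms
proof (induct zs)
  case (Cons y zs)
  then have IH: "block_of ` set (elim_steps n B zs) =
      (\<lambda>y. set (B ! (y - n))) ` {y \<in> set zs. n \<le> y}" by simp
  show ?case
  proof (cases "n \<le> y")
    case True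
    let ?row = "B ! (y - n)"
    have "pick (set zs) ?row \<in> set ?row"
      using Cons.prems True by (intro pick_in_row row_of) auto
    then have "block_of (pick (set zs) ?row, rev (filter (\<lambda>v. v \<noteq> pick (set zs) ?row) ?row)) = set ?row"
      by (auto simp: block_of_def)
    moreover have "{x \<in> set (y # zs). n \<le> x} = insert y {x \<in> set zs. n \<le> x}" using True by auto
    ultimately show ?thesis using True IH by (simp add: Let_def)
  next
    case False
    then have "{x \<in> set (y # zs). n \<le> x} = {x \<in> set zs. n \<le> x}" by auto
    with False IH show ?thesis by simp
  qed
qed simp

text \<open>The vertex \<open>p\<close> kept is the only later neighbour of the block
  \<open>y\<close>. It remains because it is the last item or has itself a later neighbour, a block
  containing it. Any other vertex of the row that lies in a later block would be an item before
  \<open>y\<close> with two later neighbours, which the ordering forbids.\<close>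

lemma elimination_suffix:
  assumes "ys = pre @ zs"
  shows "elimination (remaining zs) last_vertex (elim_steps n B zs)"
  using assms
proof (induct zs arbitrary: pre)
  case Nil
  show ?case by (simp add: remaining_def)
next
  case (Cons y zs)
  have IH: "elimination (remaining zs) last_vertex (elim_steps n B zs)"
    using Cons.hyps[of "pre @ [y]"] Cons.prems by simp
  show ?case
  proof (cases "y < n")
    case True
    then have "{x \<in> set (y # zs). n \<le> x} = {x \<in> set zs. n \<le> x}" by auto
    with IH True show ?thesis by (simp add: remaining_def)
  next
    case False
    define row where "row = B ! (y - n)"
    define p where "p = pick (set zs) row"
    have y: "y \<in> set ys" "n \<le> y" using Cons.prems False by auto
    note row = row_of[OF y, folded row_def]
    have p: "p \<in> set row" unfolding p_def by (rule pick_in_row[OF row(5)])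
    have rem: "remaining (y # zs) = set row \<union> remaining zs"
      using y by (auto simp: remaining_def row_def)
    have p_rem: "p \<in> remaining zs" and disj: "(set row - {p}) \<inter> remaining zs = {}"
    proof -
      have "p \<in> remaining zs \<and> (set row - {p}) \<inter> remaining zs = {}"
      proof (cases "zs = []")
        case True
        \<comment> \<open>No item follows, so \<open>p\<close> is the default choice that also
          defines \<open>last_vertex\<close>.\<close>
        then have "last ys = y" using Cons.prems by simp
        then have "last_vertex = p"
          using True y by (simp add: last_vertex_def p_def row_def)
        then show ?thesis using True by (auto simp: remaining_def)
      next
        case nonempty: False
        obtain w where w: "w \<in> set zs" "adj y w"
          and w_unique: "\<And>v. v \<in> set zs \<Longrightarrow> adj y v \<Longrightarrow> v = w"
          using later_unique[OF Cons.prems nonempty] by blast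
        have in_row: "v = w" if "v \<in> set row" "v \<in> set zs" for v
          using that row(3) y by (intro w_unique) (auto simp: adj_def row_def)
        have "w \<in> set row" using w y by (auto simp: adj_def row_def)
        then have "p \<in> set zs" using w unfolding p_def by (intro pick_in_set) auto
        then have "p = w" using in_row p by blast
        have "p \<in> remaining zs"
        proof -
          obtain a b where ab: "zs = a @ p # b" using \<open>p \<in> set zs\<close> by (meson split_list)
          show ?thesis
          proof (cases "b = []")
            case True
            then have "last ys = p" using Cons.prems ab by simp
            then have "last_vertex = p" using p row(3) by (auto simp: last_vertex_def)
            then show ?thesis by (simp add: remaining_def)
          next
            case False
            have "ys = (pre @ y # a) @ p # b" using Cons.prems ab by simp
            from later_unique[OF this False] obtain x where "x \<in> set b" "adj p x" by blast
            then have "n \<le> x" "p \<in> set (B ! (x - n))" "x \<in> set zs"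
              using p row(3) ab by (auto simp: adj_def)
            then show ?thesis by (auto simp: remaining_def)
          qed
        qed
        moreover have shared': False
          if u: "u \<in> set row" "u \<noteq> p" and x: "x \<in> set zs" "n \<le> x" "u \<in> set (B ! (x - n))" for u x
        proof -
          have xy: "x \<noteq> y" "x \<in> set ys" using Cons.prems distinct_ys x by auto
          then have "u \<in> set ys"
            using shared[of "y - n" "x - n" u] row(1) row_of(1)[of x] y u x by (auto simp: row_def)
          moreover have "u \<notin> set zs" using in_row u \<open>p = w\<close> by blast
          moreover have "u < n" using u row(3) by auto
          \<comment> \<open>So \<open>u\<close> precedes both \<open>y\<close> and \<open>x\<close>
            and is adjacent to both.\<close>
          ultimately have "u \<in> set pre" using Cons.prems y by auto
          then obtain a b where ab: "pre = a @ u # b" by (meson split_list)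
          then have "ys = a @ u # (b @ y # zs)" using Cons.prems by simp
          from later_unique[OF this] have "\<exists>!v. v \<in> set (b @ y # zs) \<and> adj u v" by simp
          moreover have "adj u y" "adj u x" using u x y \<open>u < n\<close> by (auto simp: adj_def row_def)
          ultimately show False using x xy by auto
        qed
        \<comment> \<open>If the last item is a vertex, it would be a second later neighbour of
          \<open>y\<close>; if it is a block, it contains \<open>last_vertex\<close>, and
          \<open>shared'\<close> applies to it.\<close>
        moreover have "u \<noteq> last_vertex" if u: "u \<in> set row" "u \<noteq> p" for u
        proof
          assume z: "u = last_vertex"
          have last: "last ys \<in> set zs" using Cons.prems nonempty by simp
          show False
          proof (cases "last ys < n")
            case True
            then show False using last z u in_row \<open>p = w\<close> by (simp add: last_vertex_def)
          next
            case False
            then have "last_vertex \<in> set (B ! (last ys - n))"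
              using row_of(5)[of "last ys"] ys_nonempty by (simp add: last_vertex_def pick_in_row)
            then show False using shared'[OF u last] False z by simp
          qed
        qed
        ultimately show ?thesis by (auto simp: remaining_def)
      qed
      then show "p \<in> remaining zs" "(set row - {p}) \<inter> remaining zs = {}" by auto
    qed
    let ?us = "rev (filter (\<lambda>v. v \<noteq> p) row)"
    have us: "set ?us = set row - {p}" by auto
    have "block_of b \<subseteq> remaining zs" if b: "b \<in> set (elim_steps n B zs)" for b
    proof -
      have "set zs \<subseteq> set ys" using Cons.prems by auto
      then obtain x where "x \<in> set zs" "n \<le> x" "block_of b = set (B ! (x - n))"
        using block_of_elim_steps b by blast
      then show ?thesis by (auto simp: remaining_def)
    qed
    then have "\<forall>b\<in>set (elim_steps n B zs). set ?us \<inter> block_of b = {}"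
      using disj us by blast
    moreover have "?us \<noteq> []"
    proof
      assume "?us = []"
      then have "set row \<subseteq> {p}" using us by auto
      from card_mono[OF _ this] show False using row by (simp add: distinct_card)
    qed
    moreover have "remaining (y # zs) - set ?us = remaining zs"
      using disj p_rem rem us by auto
    moreover have "elim_steps n B (y # zs) = (p, ?us) # elim_steps n B zs"
      using False by (simp add: Let_def row_def p_def)
    ultimately show ?thesis
      using IH p_rem rem row(2) us by (auto simp del: elim_steps.simps)
  qed
qed

lemma remaining_ys: "remaining ys = {..<n}"
proof -
  have "(\<Union>y\<in>{n..<n + length B}. set (B ! (y - n))) = {..<n}"
  proof (intro equalityI subsetI)
    fix v assume "v \<in> {..<n}"
    then obtain i where "i < length B" "v \<in> set (B ! i)" using cover by blast
    then show "v \<in> (\<Union>y\<in>{n..<n + length B}. set (B ! (y - n)))"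
      by (intro UN_I[of "n + i"]) auto
  next
    fix v assume "v \<in> (\<Union>y\<in>{n..<n + length B}. set (B ! (y - n)))"
    then obtain y where "y \<in> {n..<n + length B}" "v \<in> set (B ! (y - n))" by blast
    moreover from this have "y - n < length B" by auto
    ultimately show "v \<in> {..<n}" using rows by blast
  qed
  then show ?thesis using last_vertex_less by (auto simp: remaining_def blocks_ys)
qed

lemma elimination_ys: "elimination {..<n} last_vertex (elim_steps n B ys)"
  using elimination_suffix[of "[]" ys] remaining_ys by simp

lemma length_elim_steps: "length (elim_steps n B zs) = length (filter (\<lambda>y. n \<le> y) zs)"
  by (induct zs) (auto simp: Let_def)

text \<open>A row of length at least 2 is at most twice as long as the row without
  \<open>p\<close>.\<close>

lemma sum_rows:
  assumes "set zs \<subseteq> set ys"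
  shows "(\<Sum>y\<leftarrow>zs. if n \<le> y then length (B ! (y - n)) else 0) \<le>
    2 * (\<Sum>b\<leftarrow>elim_steps n B zs. length (snd b))"
  using assms
proof (induct zs)
  case (Cons y zs)
  show ?case
  proof (cases "n \<le> y")
    case True
    let ?row = "B ! (y - n)"
    let ?p = "pick (set zs) ?row"
    have row: "distinct ?row" "2 \<le> length ?row" "?row \<noteq> []" using Cons True row_of by auto
    have "length (filter (\<lambda>v. v \<noteq> ?p) ?row) = card (set ?row - {?p})"
      using row(1) by (subst distinct_card[symmetric]) (auto simp: set_filter intro!: arg_cong[of _ _ card])
    also have "\<dots> = length ?row - 1"
      using row pick_in_row[OF row(3)] by (simp add: distinct_card)
    finally show ?thesis using Cons True row(2) by (simp add: Let_def)
  qed (use Cons in auto)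
qed simp

lemma sum_rows_ys: "(\<Sum>y\<leftarrow>ys. if n \<le> y then length (B ! (y - n)) else 0) \<le> 2 * n"
  using sum_rows[of ys] elimination_sum_length[OF _ elimination_ys] by simp

text \<open>At least one elimination takes place, so the register of the kept vertex has been set
  before the result is read from there.\<close>

lemma elim_steps_nonempty: "elim_steps n B ys \<noteq> []"
proof -
  have "0 < length B" using cover[OF n_pos] by auto
  then have "n \<in> {y \<in> set ys. n \<le> y}" unfolding blocks_ys by auto
  then have "filter (\<lambda>y. n \<le> y) ys \<noteq> []" by (auto simp: filter_empty_conv)
  then show ?thesis using length_elim_steps[of ys] by auto
qed

text \<open>Every block deletes at least one of the \<open>n\<close> vertices.\<close>

lemma length_B: "length B \<le> n"
proof -
  have "length B = card {y \<in> set ys. n \<le> y}" by (simp add: blocks_ys)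
  also have "\<dots> = length (elim_steps n B ys)"
    using distinct_ys by (simp add: length_elim_steps distinct_card[symmetric])
  also have "\<dots> \<le> (\<Sum>b\<leftarrow>elim_steps n B ys. length (snd b))"
  proof -
    have "elimination U z es \<Longrightarrow> length es \<le> (\<Sum>b\<leftarrow>es. length (snd b))"
      for U and z :: nat and es
      by (induct U z es rule: elimination.induct) (auto simp: neq_Nil_conv)
    then show ?thesis using elimination_ys by blast
  qed
  also have "\<dots> \<le> n" using elimination_sum_length[OF _ elimination_ys] by simp
  finally show ?thesis .
qed

lemma ys_less: "y \<in> set ys \<Longrightarrow> y < 2 * n"
  using row_of(1)[of y] length_B by (cases "n \<le> y") auto

lemma length_ys: "length ys \<le> 2 * n"
proof -
  have "set ys \<subseteq> {..<2 * n}" using ys_less by auto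
  from card_mono[OF _ this] show ?thesis using distinct_ys by (simp add: distinct_card)
qed

end

text \<open>Blocks containing \<open>v\<close> overlap in \<open>v\<close> only: if
  \<open>v = p\<close>, the vertices \<open>us\<close> are in no later block, and if
  \<open>v\<close> is in \<open>us\<close>, no later block contains \<open>v\<close>.\<close>

lemma received_eq_sum:
  assumes "elimination U z es"
  shows "received es f v = sum f (\<Union>b\<in>{b \<in> set es. v \<in> block_of b}. block_of b - {v})"
  using assms
proof (induct U z es rule: elimination.induct)
  case (1 U z)
  show ?case by (simp add: received_def)
next
  case (2 U z p us es)
  let ?N = "\<lambda>es. \<Union>b\<in>{b \<in> set es. v \<in> block_of b}. block_of b - {v}"
  have IH: "received es f v = sum f (?N es)" using 2 by simp
  show ?case
  proof (cases "v \<in> block_of (p, us)")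
    case True
    have "?N ((p, us) # es) = (block_of (p, us) - {v}) \<union> ?N es" using True by auto
    moreover have "(block_of (p, us) - {v}) \<inter> ?N es = {}"
      using 2(2) True by (auto simp: block_of_def)
    ultimately show ?thesis
      using True IH by (simp add: received_Cons sum.union_disjoint)
  next
    case False
    then have "{b \<in> set ((p, us) # es). v \<in> block_of b} = {b \<in> set es. v \<in> block_of b}" by auto
    with False IH show ?thesis by (simp add: received_Cons)
  qed
qed

section \<open>Domination with penalties\<close>

text \<open>Before any elimination, a zero receiving less than 2 pays the penalty, and any other
  vertex pays its value.\<close>

definition init_cost :: "'a \<Rightarrow> nat \<Rightarrow> nat" where
  "init_cost v q = (if q < 2 then 2 else q - 2)"

lemma regular_init_cost: "regular (init_cost v)"
  by (auto simp: regular_def init_cost_def)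

lemma init_cost_key: "init_cost v (key a r) = (if a = 0 \<and> r < 2 then 2 else a)"
  by (auto simp: init_cost_def key_def)

lemma bound_init_cost: "bound init_cost v = 2"
proof -
  have "init_cost v ` {..4} = {2, 0, 1}"
  proof (intro equalityI subsetI)
    fix c assume "c \<in> {2, 0, 1 :: nat}"
    then show "c \<in> init_cost v ` {..4}"
      by (intro image_eqI[of _ _ "c + 2"]) (auto simp: init_cost_def)
  qed (auto simp: init_cost_def)
  then show ?thesis by (simp add: bound_def)
qed

text \<open>Raising all violating zeros to 2 turns penalties into weight and lowers no received sum.
  Conversely, a dominating function pays no penalty.\<close>

lemma opt_init_cost:
  assumes "fin_digraph G"
    and received: "\<And>f v. v \<in> verts G \<Longrightarrow> received es f v = (\<Sum>u | v \<rightarrow>\<^bsub>G\<^esub> u. f u)"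
  shows "opt (verts G) es init_cost = roman2_domination_number G"
proof -
  interpret fin_digraph G by fact
  let ?A = "{f. \<forall>v. f v \<le> (2 :: nat)}"
  let ?t = "total (verts G) es init_cost"
  let ?R = "\<lambda>w. \<exists>f. roman2_dominating G f \<and> (\<Sum>v \<in> verts G. f v) = w"
  have 1: "\<exists>w \<le> ?t f. ?R w" if "f \<in> ?A" for f
  proof -
    define g where "g v = (if f v = 0 \<and> received es f v < 2 then 2 else f v)" for v
    have fg: "f v \<le> g v" for v by (simp add: g_def)
    have "g ` verts G \<subseteq> {0, 1, 2}"
    proof
      fix a assume "a \<in> g ` verts G"
      then have "a \<le> 2" using that by (auto simp: g_def)
      then show "a \<in> {0, 1, 2}" by (simp, arith)
    qed
    moreover have "2 \<le> (\<Sum>u | v \<rightarrow>\<^bsub>G\<^esub> u. g u)" if v: "v \<in> verts G" "g v = 0" for v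
    proof -
      have "2 \<le> received es f v" using v(2) by (auto simp: g_def split: if_splits)
      also have "\<dots> \<le> (\<Sum>u | v \<rightarrow>\<^bsub>G\<^esub> u. g u)"
        unfolding received[OF v(1)] by (intro sum_mono fg)
      finally show ?thesis .
    qed
    ultimately have "roman2_dominating G g" by (simp add: roman2_dominating_def)
    moreover have "(\<Sum>v \<in> verts G. g v) = ?t f"
      unfolding total_def init_cost_key by (intro sum.cong) (auto simp: g_def)
    ultimately show ?thesis by blast
  qed
  have 2: "\<exists>g \<in> ?A. ?t g = w" if w: "?R w" for w
  proof -
    obtain f where f: "roman2_dominating G f" "(\<Sum>v \<in> verts G. f v) = w" using w by blast
    \<comment> \<open>Domination says nothing about values outside the graph, whereas
      \<open>opt\<close> bounds the function everywhere.\<close>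
    define g where "g v = (if v \<in> verts G then f v else 0)" for v
    have "received es g v = received es f v" if "v \<in> verts G" for v
      unfolding received[OF that] by (intro sum.cong) (auto simp: g_def)
    then have "init_cost v (key (g v) (received es g v)) = f v" if "v \<in> verts G" for v
      using f(1) that received[OF that, of f]
      by (auto simp: init_cost_key g_def roman2_dominating_def)
    then have "?t g = w" using f(2) by (simp add: total_def)
    moreover have "g \<in> ?A" using f(1) by (fastforce simp: g_def roman2_dominating_def)
    ultimately show ?thesis by blast
  qed
  have "?A \<noteq> {}" by (auto intro: exI[of _ "\<lambda>_. 0"])
  then have "opt (verts G) es init_cost \<in> ?t ` ?A"
    unfolding opt_def by (intro Inf_nat_def1) auto
  then obtain f where f: "f \<in> ?A" "opt (verts G) es init_cost = ?t f" by blast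
  obtain w where w: "w \<le> ?t f" "?R w" using 1[OF f(1)] by blast
  show ?thesis
  proof (rule antisym)
    have "?R (roman2_domination_number G)"
      unfolding roman2_domination_number_def using w(2) by (rule LeastI[of ?R])
    then obtain g where g: "g \<in> ?A" "?t g = roman2_domination_number G" using 2 by blast
    have "opt (verts G) es init_cost \<le> ?t g"
      unfolding opt_def by (rule cINF_lower[OF bdd_below_bot g(1)])
    then show "opt (verts G) es init_cost \<le> roman2_domination_number G" using g(2) by simp
    have "roman2_domination_number G \<le> w"
      unfolding roman2_domination_number_def using w(2) by (rule Least_le[of ?R])
    then show "roman2_domination_number G \<le> opt (verts G) es init_cost" using w f by simp
  qed
qed

section \<open>Running programs\<close>

text \<open>\<open>sem\<close>, \<open>safe\<close> and \<open>cost\<close> are meant for programs without loops only.\<close>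

fun sem :: "prog \<Rightarrow> machine_state \<Rightarrow> machine_state" where
  "sem Skip s = s"
| "sem (Move x a) (r, m) = (r(x := operand_val r a), m)"
| "sem (Add x a b) (r, m) = (r(x := operand_val r a + operand_val r b), m)"
| "sem (Sub x a b) (r, m) = (r(x := operand_val r a - operand_val r b), m)"
| "sem (Load x A i) (r, m) = (r(x := m A (operand_val r i)), m)"
| "sem (Store A i a) (r, m) = (r, m(A := (m A)(operand_val r i := operand_val r a)))"
| "sem (Seq P Q) s = sem Q (sem P s)"
| "sem (Cond b P Q) s = (if test_val (fst s) b then sem P s else sem Q s)"
| "sem (While b P) s = s"

fun safe :: "nat \<Rightarrow> prog \<Rightarrow> machine_state \<Rightarrow> bool" where
  "safe W Skip s \<longleftrightarrow> True"
| "safe W (Move x a) (r, m) \<longleftrightarrow> operand_val r a \<le> W"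
| "safe W (Add x a b) (r, m) \<longleftrightarrow> operand_val r a + operand_val r b \<le> W"
| "safe W (Sub x a b) (r, m) \<longleftrightarrow> operand_val r a - operand_val r b \<le> W"
| "safe W (Load x A i) (r, m) \<longleftrightarrow> operand_val r i \<le> W \<and> m A (operand_val r i) \<le> W"
| "safe W (Store A i a) (r, m) \<longleftrightarrow> operand_val r i \<le> W \<and> operand_val r a \<le> W"
| "safe W (Seq P Q) s \<longleftrightarrow> safe W P s \<and> safe W Q (sem P s)"
| "safe W (Cond b P Q) s \<longleftrightarrow> (if test_val (fst s) b then safe W P s else safe W Q s)"
| "safe W (While b P) s \<longleftrightarrow> False"

fun cost :: "prog \<Rightarrow> nat" where
  "cost (Seq P Q) = cost P + cost Q"
| "cost (Cond b P Q) = 1 + max (cost P) (cost Q)"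
| "cost P = 1"

text \<open>Total correctness with a time bound. It includes that no word exceeds \<open>W\<close>,
  since otherwise \<open>exec\<close> has no transition.\<close>

definition runs :: "nat \<Rightarrow> prog \<Rightarrow> machine_state \<Rightarrow> nat \<Rightarrow> (machine_state \<Rightarrow> bool) \<Rightarrow> bool" where
  "runs W P s T Q \<longleftrightarrow> (\<exists>t s'. exec W P s t s' \<and> t \<le> T \<and> Q s')"

lemma safe_exec: "safe W P s \<Longrightarrow> \<exists>t\<le>cost P. exec W P s t (sem P s)"
proof (induct P arbitrary: s)
  case (Seq P Q)
  then obtain t u where "t \<le> cost P" "exec W P s t (sem P s)"
    "u \<le> cost Q" "exec W Q (sem P s) u (sem Q (sem P s))" by (metis safe.simps(7))
  then show ?case by (intro exI[of _ "t + u"]) (auto intro: exec.Seq)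
next
  case (Cond b P Q)
  show ?case
  proof (cases "test_val (fst s) b")
    case True
    then obtain t where "t \<le> cost P" "exec W P s t (sem P s)"
      using Cond.hyps(1)[of s] Cond.prems by auto
    with True show ?thesis by (intro exI[of _ "1 + t"]) (auto intro: exec.Cond_True[simplified])
  next
    case False
    then obtain t where "t \<le> cost Q" "exec W Q s t (sem Q s)"
      using Cond.hyps(2)[of s] Cond.prems by auto
    with False show ?thesis by (intro exI[of _ "1 + t"]) (auto intro: exec.Cond_False[simplified])
  qed
next
  case (Move x a)
  then show ?case by (cases s) (auto intro!: exI[of _ 1] exec.Move[simplified])
next
  case (Add x a b)
  then show ?case by (cases s) (auto intro!: exI[of _ 1] exec.Add[simplified])
next
  case (Sub x a b)
  then show ?case by (cases s) (auto intro!: exI[of _ 1] exec.Sub[simplified])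
next
  case (Load x A i)
  then show ?case by (cases s) (auto intro!: exI[of _ 1] exec.Load[simplified])
next
  case (Store A i a)
  then show ?case by (cases s) (auto intro!: exI[of _ 1] exec.Store[simplified])
qed (auto intro!: exI[of _ 1] exec.Skip[simplified])

lemma runs_straight: "safe W P s \<Longrightarrow> Q (sem P s) \<Longrightarrow> cost P \<le> T \<Longrightarrow> runs W P s T Q"
  unfolding runs_def using safe_exec by (meson le_trans)

lemma runs_mono: "runs W P s T Q \<Longrightarrow> T \<le> T' \<Longrightarrow> (\<And>s'. Q s' \<Longrightarrow> Q' s') \<Longrightarrow> runs W P s T' Q'"
  unfolding runs_def by (meson le_trans)

lemma runs_Seq:
  assumes "runs W P s T R" "\<And>s'. R s' \<Longrightarrow> runs W Q s' T' S"
  shows "runs W (Seq P Q) s (T + T') S"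
  using assms unfolding runs_def by (meson add_le_mono exec.Seq)

lemma runs_Cond:
  assumes "test_val (fst s) b \<Longrightarrow> runs W P s T R" "\<not> test_val (fst s) b \<Longrightarrow> runs W Q s T R"
  shows "runs W (Cond b P Q) s (1 + T) R"
  using assms unfolding runs_def by (meson add_left_mono exec.Cond_True exec.Cond_False)

text \<open>The cost may depend on the round, so that the rounds of the main loop can be charged
  with the sizes of their blocks.\<close>

lemma runs_While:
  assumes "I 0 s"
    and step: "\<And>k s. k < N \<Longrightarrow> I k s \<Longrightarrow> test_val (fst s) b \<and> runs W P s (c k) (I (Suc k))"
    and stop: "\<And>s. I N s \<Longrightarrow> \<not> test_val (fst s) b"
  shows "runs W (While b P) s ((\<Sum>k<N. c k + 1) + 1) (I N)"
proof -
  have "runs W (While b P) s ((\<Sum>k\<in>{k..<N}. c k + 1) + 1) (I N)" if "k \<le> N" "I k s" for k s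
    using that
  proof (induct k arbitrary: s rule: inc_induct)
    case base
    then have "exec W (While b P) s 1 s" by (intro exec.While_False stop)
    with base show ?case unfolding runs_def by (intro exI[of _ 1] exI[of _ s]) simp
  next
    case (step k)
    note 1 = assms(2)[OF step(2,4)]
    obtain t s' where t: "exec W P s t s'" "t \<le> c k" "I (Suc k) s'"
      using 1 unfolding runs_def by blast
    from step(3)[OF this(3)] obtain u s'' where u: "exec W (While b P) s' u s''"
      "u \<le> (\<Sum>k\<in>{Suc k..<N}. c k + 1) + 1" "I N s''" unfolding runs_def by blast
    have "exec W (While b P) s (1 + t + u) s''"
      using 1 t(1) u(1) by (intro exec.While_True) auto
    moreover have "1 + t + u \<le> (\<Sum>k\<in>{k..<N}. c k + 1) + 1"
      using t(2) u(2) step(2) by (simp add: sum.atLeast_Suc_lessThan)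
    ultimately show ?case using u(3) unfolding runs_def by blast
  qed
  from this[of 0 s] show ?thesis using assms(1) by (simp add: atLeast0LessThan)
qed

text \<open>The final \<open>Skip\<close> takes a step of its own, which the time bounds
  include.\<close>

fun seqs :: "prog list \<Rightarrow> prog" where
  "seqs [] = Skip"
| "seqs (P # Ps) = Seq P (seqs Ps)"

section \<open>The program\<close>

text \<open>
  Registers: \<open>3\<close> loop counter, \<open>4\<close> current item or block, \<open>5\<close>, \<open>6\<close>, \<open>9\<close> position in the current
  row, its end and its start, \<open>7\<close> the vertex \<open>p\<close> kept, \<open>8\<close> current vertex, \<open>10 + q\<close> table entry
  \<open>q\<close> of one vertex, \<open>15, \<dots>, 18\<close> temporary, \<open>20 + 3 * s + j\<close> the value of \<open>dp\<close> at \<open>s\<close>, \<open>j\<close>.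
  Arrays: \<open>7 + q\<close> table entry \<open>q\<close>, \<open>12\<close> flags of the items still to come.
\<close>

definition min_sum :: "nat \<Rightarrow> nat \<Rightarrow> nat \<Rightarrow> nat \<Rightarrow> nat \<Rightarrow> nat \<Rightarrow> nat \<Rightarrow> prog" where
  "min_sum d a1 b1 a2 b2 a3 b3 = seqs
     [Add 15 (Reg a1) (Reg b1), Add 16 (Reg a2) (Reg b2), Add 17 (Reg a3) (Reg b3),
      Cond (Less (Reg 16) (Reg 15)) (Move 15 (Reg 16)) Skip,
      Cond (Less (Reg 17) (Reg 15)) (Move 15 (Reg 17)) Skip,
      Move d (Reg 15)]"

definition load_tables :: "nat \<Rightarrow> prog" where
  "load_tables x = seqs [Load 10 7 (Reg x), Load 11 8 (Reg x), Load 12 9 (Reg x),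
     Load 13 10 (Reg x), Load 14 11 (Reg x)]"

definition init_tables :: prog where
  "init_tables = Seq (Move 3 (Const 0)) (While (Less (Reg 3) (Reg 0)) (seqs
     [Store 7 (Reg 3) (Const 2), Store 8 (Reg 3) (Const 2), Store 9 (Reg 3) (Const 0),
      Store 10 (Reg 3) (Const 1), Store 11 (Reg 3) (Const 2), Add 3 (Reg 3) (Const 1)]))"

definition init_flags :: prog where
  "init_flags = Seq (Move 3 (Const 0)) (While (Less (Reg 3) (Reg 2)) (seqs
     [Load 4 6 (Reg 3), Store 12 (Reg 4) (Const 1), Add 3 (Reg 3) (Const 1)]))"

definition find_row :: prog where
  "find_row = seqs [Sub 4 (Reg 4) (Reg 0), Load 5 2 (Reg 4), Add 6 (Reg 4) (Const 1),
     Load 6 2 (Reg 6), Move 9 (Reg 5), Load 7 3 (Reg 5)]"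

definition find_parent :: prog where
  "find_parent = While (Less (Reg 5) (Reg 6)) (seqs
     [Load 8 3 (Reg 5), Load 10 12 (Reg 8), Cond (Equal (Reg 10) (Const 1)) (Move 7 (Reg 8)) Skip,
      Add 5 (Reg 5) (Const 1)])"

definition init_dp :: prog where
  "init_dp = seqs [Move 5 (Reg 9),
     Move 20 (Const 0), Move 21 (Const 2), Move 22 (Const 2),
     Move 23 (Const 0), Move 24 (Const 2), Move 25 (Const 2),
     Move 26 (Const 0), Move 27 (Const 2), Move 28 (Const 2)]"

text \<open>The three entries are updated in place from \<open>j = 2\<close> down to
  \<open>j = 0\<close>, because each depends on old entries with smaller \<open>j\<close>
  (differences being cut off at 0). This works as \<open>min_sum\<close> writes its target
  last.\<close>

definition relax_row :: "nat \<Rightarrow> nat \<Rightarrow> prog" where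
  "relax_row d x = seqs
     [min_sum (d + 2) (d + 2) x (d + 1) 13 d 14, min_sum (d + 1) (d + 1) x d 13 d 14,
      min_sum d d x d 13 d 14]"

definition relax_dp :: prog where
  "relax_dp = seqs [relax_row 20 10, relax_row 23 11, relax_row 26 12]"

definition compute_dp :: prog where
  "compute_dp = While (Less (Reg 5) (Reg 6)) (seqs
     [Load 8 3 (Reg 5),
      Cond (Equal (Reg 8) (Reg 7)) Skip (Seq (load_tables 8) relax_dp),
      Add 5 (Reg 5) (Const 1)])"

definition store_min_sum :: "nat \<Rightarrow> nat \<Rightarrow> nat \<Rightarrow> nat \<Rightarrow> nat \<Rightarrow> nat \<Rightarrow> nat \<Rightarrow> prog" where
  "store_min_sum A a1 b1 a2 b2 a3 b3 =
     Seq (min_sum 18 a1 b1 a2 b2 a3 b3) (Store A (Reg 7) (Reg 18))"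

text \<open>All old entries are loaded before the first one is overwritten. The register pairs are
  those of \<open>newval_entries\<close>.\<close>

definition update_tables :: prog where
  "update_tables = seqs [load_tables 7,
     store_min_sum 7 10 20 11 24 12 28, store_min_sum 8 11 20 12 24 12 28,
     store_min_sum 9 12 20 12 24 12 28, store_min_sum 10 13 23 13 27 13 28,
     store_min_sum 11 14 26 14 27 14 28]"

definition eliminate_block :: prog where
  "eliminate_block = Seq find_row (Seq find_parent (Seq init_dp (Seq compute_dp update_tables)))"

text \<open>Clearing the flag of the current item first leaves exactly the later items flagged,
  which are the candidates for \<open>pick\<close>.\<close>

definition main_loop :: prog where
  "main_loop = Seq (Move 3 (Const 0)) (While (Less (Reg 3) (Reg 2))
     (Seq (seqs [Load 4 6 (Reg 3), Store 12 (Reg 4) (Const 0)])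
       (Seq (Cond (Less (Reg 4) (Reg 0)) Skip eliminate_block) (Add 3 (Reg 3) (Const 1)))))"

text \<open>Register 7 still holds the vertex kept by the last elimination, which is the
  survivor.\<close>

definition read_result :: prog where
  "read_result = seqs [load_tables 7,
     Cond (Less (Reg 13) (Reg 10)) (Move 10 (Reg 13)) Skip,
     Cond (Less (Reg 14) (Reg 10)) (Move 10 (Reg 14)) Skip,
     Move 0 (Reg 10)]"

definition roman2_program :: prog where
  "roman2_program = Seq init_tables (Seq init_flags (Seq main_loop read_result))"

section \<open>Loop-free pieces of the program\<close>

lemma cost_min_sum: "cost (min_sum d a1 b1 a2 b2 a3 b3) = 9"
  by (simp add: min_sum_def)

lemma sem_min_sum:
  assumes "{a1, b1, a2, b2, a3, b3} \<inter> {15, 16, 17} = {}"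
  shows "sem (min_sum d a1 b1 a2 b2 a3 b3) (r, m) =
    (let M = min (r a1 + r b1) (min (r a2 + r b2) (r a3 + r b3))
     in (r(15 := M, 16 := r a2 + r b2, 17 := r a3 + r b3, d := M), m))"
  using assms by (auto simp: min_sum_def Let_def fun_eq_iff min_def)

lemma min_sum:
  assumes "{a1, b1, a2, b2, a3, b3} \<inter> {15, 16, 17} = {}"
  shows "\<exists>r'. sem (min_sum d a1 b1 a2 b2 a3 b3) (r, m) = (r', m) \<and>
    r' d = min (r a1 + r b1) (min (r a2 + r b2) (r a3 + r b3)) \<and>
    (\<forall>y. y \<notin> {15, 16, 17, d} \<longrightarrow> r' y = r y)"
proof (intro exI conjI)
  let ?M = "min (r a1 + r b1) (min (r a2 + r b2) (r a3 + r b3))"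
  show "sem (min_sum d a1 b1 a2 b2 a3 b3) (r, m) =
      (r(15 := ?M, 16 := r a2 + r b2, 17 := r a3 + r b3, d := ?M), m)"
    using sem_min_sum[OF assms] by (simp only: Let_def)
qed auto

lemma safe_min_sum:
  assumes "{a1, b1, a2, b2, a3, b3} \<inter> {15, 16, 17} = {}"
  shows "safe W (min_sum d a1 b1 a2 b2 a3 b3) (r, m) \<longleftrightarrow>
    r a1 + r b1 \<le> W \<and> r a2 + r b2 \<le> W \<and> r a3 + r b3 \<le> W"
  using assms by (auto simp: min_sum_def)

definition dp_registers :: "(nat \<Rightarrow> nat) \<Rightarrow> (nat \<Rightarrow> nat \<Rightarrow> nat) \<Rightarrow> nat list \<Rightarrow> bool" where
  "dp_registers r \<phi> us \<longleftrightarrow>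
     r 20 = dp \<phi> 0 us 0 \<and> r 21 = dp \<phi> 0 us 1 \<and> r 22 = dp \<phi> 0 us 2 \<and>
     r 23 = dp \<phi> 1 us 0 \<and> r 24 = dp \<phi> 1 us 1 \<and> r 25 = dp \<phi> 1 us 2 \<and>
     r 26 = dp \<phi> 2 us 0 \<and> r 27 = dp \<phi> 2 us 1 \<and> r 28 = dp \<phi> 2 us 2"

definition table_registers :: "(nat \<Rightarrow> nat) \<Rightarrow> (nat \<Rightarrow> nat) \<Rightarrow> bool" where
  "table_registers r c \<longleftrightarrow> r 10 = c 0 \<and> r 11 = c 1 \<and> r 12 = c 2 \<and> r 13 = c 3 \<and> r 14 = c 4"

lemma relax_row:
  assumes "20 \<le> d" "x \<in> {10, 11, 12}"
    and "\<And>i q. i \<le> 2 \<Longrightarrow> q \<in> {10..14} \<Longrightarrow> r (d + i) + r q \<le> W"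
  shows "\<exists>r'. sem (relax_row d x) (r, m) = (r', m) \<and> safe W (relax_row d x) (r, m) \<and>
    (\<forall>y. y < 15 \<or> 18 \<le> y \<and> y < d \<or> d + 2 < y \<longrightarrow> r' y = r y) \<and>
    r' d = min (r x + r d) (min (r 13 + r d) (r 14 + r d)) \<and>
    r' (d + 1) = min (r x + r (d + 1)) (min (r 13 + r d) (r 14 + r d)) \<and>
    r' (d + 2) = min (r x + r (d + 2)) (min (r 13 + r (d + 1)) (r 14 + r d))"
proof -
  define P2 P1 P0 where P: "P2 = min_sum (d + 2) (d + 2) x (d + 1) 13 d 14"
    "P1 = min_sum (d + 1) (d + 1) x d 13 d 14" "P0 = min_sum d d x d 13 d 14"
  have row: "relax_row d x = seqs [P2, P1, P0]" by (simp only: relax_row_def P)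
  have x: "10 \<le> x" "x \<le> 12" using assms(2) by auto
  have disj: "{d + 2, x, d + 1, 13, d, 14} \<inter> {15, 16, 17} = {}"
    "{d + 1, x, d, 13, d, 14} \<inter> {15, 16, 17} = {}" "{d, x, d, 13, d, 14} \<inter> {15, 16, 17} = {}"
    using assms(1) x by auto
  obtain r2 where r2: "sem P2 (r, m) = (r2, m)"
    "r2 (d + 2) = min (r (d + 2) + r x) (min (r (d + 1) + r 13) (r d + r 14))"
    "\<forall>y. y \<notin> {15, 16, 17, d + 2} \<longrightarrow> r2 y = r y"
    unfolding P using min_sum[OF disj(1), of "d + 2" r m] by blast
  obtain r1 where r1: "sem P1 (r2, m) = (r1, m)"
    "r1 (d + 1) = min (r2 (d + 1) + r2 x) (min (r2 d + r2 13) (r2 d + r2 14))"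
    "\<forall>y. y \<notin> {15, 16, 17, d + 1} \<longrightarrow> r1 y = r2 y"
    unfolding P using min_sum[OF disj(2), of "d + 1" r2 m] by blast
  obtain r0 where r0: "sem P0 (r1, m) = (r0, m)"
    "r0 d = min (r1 d + r1 x) (min (r1 d + r1 13) (r1 d + r1 14))"
    "\<forall>y. y \<notin> {15, 16, 17, d} \<longrightarrow> r0 y = r1 y"
    unfolding P using min_sum[OF disj(3), of d r1 m] by blast
  have r2_eq: "r2 d = r d" "r2 (d + 1) = r (d + 1)" "r2 x = r x" "r2 13 = r 13" "r2 14 = r 14"
    using assms(1) x by (auto intro!: r2(3)[rule_format])
  moreover have r1_eq: "r1 d = r2 d" "r1 (d + 2) = r2 (d + 2)" "r1 x = r2 x" "r1 13 = r2 13"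
    "r1 14 = r2 14"
    using assms(1) x by (auto intro!: r1(3)[rule_format])
  moreover have "r0 (d + 1) = r1 (d + 1)" "r0 (d + 2) = r1 (d + 2)"
    using assms(1) by (auto intro!: r0(3)[rule_format])
  ultimately have vals: "r0 d = min (r x + r d) (min (r 13 + r d) (r 14 + r d))"
    "r0 (d + 1) = min (r x + r (d + 1)) (min (r 13 + r d) (r 14 + r d))"
    "r0 (d + 2) = min (r x + r (d + 2)) (min (r 13 + r (d + 1)) (r 14 + r d))"
    using r0(2) r1(2) r2(2) by (simp_all only: add.commute)
  show ?thesis
  proof (intro exI[of _ r0] conjI allI impI vals)
    show "sem (relax_row d x) (r, m) = (r0, m)"
      by (simp add: row r0(1) r1(1) r2(1))
    have "safe W P2 (r, m)" "safe W P1 (r2, m)" "safe W P0 (r1, m)"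
      unfolding P using assms(1) assms(3)[of 0] assms(3)[of 1] assms(3)[of 2] x r2_eq r1_eq
      by (subst safe_min_sum; force)+
    then show "safe W (relax_row d x) (r, m)"
      by (simp add: row r0(1) r1(1) r2(1))
    show "r0 y = r y" if "y < 15 \<or> 18 \<le> y \<and> y < d \<or> d + 2 < y" for y
    proof -
      have "y \<notin> {15, 16, 17, d}" "y \<notin> {15, 16, 17, d + 1}" "y \<notin> {15, 16, 17, d + 2}"
        using that assms(1) by auto
      then show ?thesis using r0(3) r1(3) r2(3) by metis
    qed
  qed
qed

lemma relax_dp:
  assumes "dp_registers r \<phi> us" "table_registers r (\<phi> u)"
    and "\<And>s j. dp \<phi> s us j \<le> K" "\<And>q. q \<le> 4 \<Longrightarrow> \<phi> u q \<le> K" "2 * K \<le> W"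
  shows "\<exists>r'. sem relax_dp (r, m) = (r', m) \<and> safe W relax_dp (r, m) \<and>
    dp_registers r' \<phi> (u # us) \<and> (\<forall>y<10. r' y = r y)"
proof -
  have D: "r q \<le> K" if "q \<in> {20..28}" for q
  proof -
    have "q \<in> {20, 21, 22, 23, 24, 25, 26, 27, 28}" using that by auto
    then show ?thesis using assms(1,3) by (auto simp: dp_registers_def)
  qed
  have T: "r q \<le> K" if "q \<in> {10..14}" for q
  proof -
    have "q \<in> {10, 11, 12, 13, 14}" using that by auto
    then show ?thesis using assms(2,4) by (auto simp: table_registers_def)
  qed
  have sum: "r (d + i) + r q \<le> W" if "i \<le> 2" "q \<in> {10..14}" "20 \<le> d" "d \<le> 26" for d i q
    using D[of "d + i"] T[of q] assms(5) that by auto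
  have sum0: "r (20 + i) + r q \<le> W" if "i \<le> 2" "q \<in> {10..14}" for i q
    using sum[OF that, of 20] by simp
  obtain r1 where r1: "sem (relax_row 20 10) (r, m) = (r1, m)" "safe W (relax_row 20 10) (r, m)"
    "\<forall>y. y < 15 \<or> 18 \<le> y \<and> y < 20 \<or> 22 < y \<longrightarrow> r1 y = r y"
    "r1 20 = min (r 10 + r 20) (min (r 13 + r 20) (r 14 + r 20))"
    "r1 21 = min (r 10 + r 21) (min (r 13 + r 20) (r 14 + r 20))"
    "r1 22 = min (r 10 + r 22) (min (r 13 + r 21) (r 14 + r 20))"
    using relax_row[of 20 10 r W m, OF _ _ sum0] by auto
  have sum1: "r1 (23 + i) + r1 q \<le> W" if "i \<le> 2" "q \<in> {10..14}" for i q
    using sum[OF that, of 23] r1(3)[rule_format, of "23 + i"] r1(3)[rule_format, of q] that by simp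
  obtain r2 where r2: "sem (relax_row 23 11) (r1, m) = (r2, m)" "safe W (relax_row 23 11) (r1, m)"
    "\<forall>y. y < 15 \<or> 18 \<le> y \<and> y < 23 \<or> 25 < y \<longrightarrow> r2 y = r1 y"
    "r2 23 = min (r1 11 + r1 23) (min (r1 13 + r1 23) (r1 14 + r1 23))"
    "r2 24 = min (r1 11 + r1 24) (min (r1 13 + r1 23) (r1 14 + r1 23))"
    "r2 25 = min (r1 11 + r1 25) (min (r1 13 + r1 24) (r1 14 + r1 23))"
    using relax_row[of 23 11 r1 W m, OF _ _ sum1] by auto
  have sum2: "r2 (26 + i) + r2 q \<le> W" if "i \<le> 2" "q \<in> {10..14}" for i q
    using sum[OF that, of 26] r1(3)[rule_format, of "26 + i"] r1(3)[rule_format, of q] r2(3)[rule_format, of "26 + i"] r2(3)[rule_format, of q] that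
    by simp
  obtain r3 where r3: "sem (relax_row 26 12) (r2, m) = (r3, m)" "safe W (relax_row 26 12) (r2, m)"
    "\<forall>y. y < 15 \<or> 18 \<le> y \<and> y < 26 \<or> 28 < y \<longrightarrow> r3 y = r2 y"
    "r3 26 = min (r2 12 + r2 26) (min (r2 13 + r2 26) (r2 14 + r2 26))"
    "r3 27 = min (r2 12 + r2 27) (min (r2 13 + r2 26) (r2 14 + r2 26))"
    "r3 28 = min (r2 12 + r2 28) (min (r2 13 + r2 27) (r2 14 + r2 26))"
    using relax_row[of 26 12 r2 W m, OF _ _ sum2] by auto
  show ?thesis
  proof (intro exI[of _ r3] conjI allI impI)
    show "sem relax_dp (r, m) = (r3, m)" "safe W relax_dp (r, m)"
      by (simp_all add: relax_dp_def r1(1,2) r2(1,2) r3(1,2))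
    show "r3 y = r y" if "y < 10" for y using that r1(3) r2(3) r3(3) by simp
    have "r3 20 = r1 20" "r3 21 = r1 21" "r3 22 = r1 22" "r3 23 = r2 23" "r3 24 = r2 24" "r3 25 = r2 25"
      "r1 11 = r 11" "r1 12 = r 12" "r1 13 = r 13" "r1 14 = r 14"
      "r2 12 = r 12" "r2 13 = r 13" "r2 14 = r 14"
      "r1 23 = r 23" "r1 24 = r 24" "r1 25 = r 25" "r2 26 = r 26" "r2 27 = r 27" "r2 28 = r 28"
      using r1(3) r2(3) r3(3) by simp_all
    note eqs = this
    have nums: "key 0 0 = 0" "key 0 1 = 1" "key 0 2 = 2"
      "(0 :: nat) - 1 = 0" "(0 :: nat) - 2 = 0" "(1 :: nat) - 1 = 0" "(1 :: nat) - 2 = 0"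
      "(2 :: nat) - 1 = 1" "(2 :: nat) - 2 = 0" by (simp_all add: key_def)
    show "dp_registers r3 \<phi> (u # us)"
      unfolding dp_registers_def dp.simps nums
      by (simp only: eqs r1(4-6) r2(4-6) r3(4-6) assms(1)[unfolded dp_registers_def]
          assms(2)[unfolded table_registers_def])
  qed
qed

lemma store_min_sum:
  assumes "{a1, b1, a2, b2, a3, b3} \<inter> {15, 16, 17, 18} = {}"
    and "r a1 + r b1 \<le> W" "r a2 + r b2 \<le> W" "r a3 + r b3 \<le> W" "r 7 \<le> W"
  shows "\<exists>r'. sem (store_min_sum A a1 b1 a2 b2 a3 b3) (r, m) =
      (r', m(A := (m A)(r 7 := min (r a1 + r b1) (min (r a2 + r b2) (r a3 + r b3))))) \<and>
    safe W (store_min_sum A a1 b1 a2 b2 a3 b3) (r, m) \<and>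
    (\<forall>y. y \<notin> {15, 16, 17, 18} \<longrightarrow> r' y = r y)"
proof -
  have disj: "{a1, b1, a2, b2, a3, b3} \<inter> {15, 16, 17} = {}" using assms(1) by auto
  obtain r' where r': "sem (min_sum 18 a1 b1 a2 b2 a3 b3) (r, m) = (r', m)"
    "r' 18 = min (r a1 + r b1) (min (r a2 + r b2) (r a3 + r b3))"
    "\<forall>y. y \<notin> {15, 16, 17, 18} \<longrightarrow> r' y = r y"
    using min_sum[OF disj, of 18 r m] by blast
  show ?thesis
    using assms(2-) r' safe_min_sum[OF disj, of W 18 r m]
    by (intro exI[of _ r']) (auto simp: store_min_sum_def min.coboundedI1)
qed

text \<open>Hence three rows of \<open>dp\<close> registers suffice, although \<open>newval\<close>
  refers to \<open>s\<close> up to 4.\<close>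

lemma dp_cap: "2 \<le> s \<Longrightarrow> dp \<phi> s us j = dp \<phi> 2 us j"
  by (induct us arbitrary: j) (simp_all add: key_def)

lemma newval_entries:
  "newval \<phi> p us 0 = min (\<phi> p 0 + dp \<phi> 0 us 0) (min (\<phi> p 1 + dp \<phi> 1 us 1) (\<phi> p 2 + dp \<phi> 2 us 2))"
  "newval \<phi> p us 1 = min (\<phi> p 1 + dp \<phi> 0 us 0) (min (\<phi> p 2 + dp \<phi> 1 us 1) (\<phi> p 2 + dp \<phi> 2 us 2))"
  "newval \<phi> p us 2 = min (\<phi> p 2 + dp \<phi> 0 us 0) (min (\<phi> p 2 + dp \<phi> 1 us 1) (\<phi> p 2 + dp \<phi> 2 us 2))"
  "newval \<phi> p us 3 = min (\<phi> p 3 + dp \<phi> 1 us 0) (min (\<phi> p 3 + dp \<phi> 2 us 1) (\<phi> p 3 + dp \<phi> 2 us 2))"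
  "newval \<phi> p us 4 = min (\<phi> p 4 + dp \<phi> 2 us 0) (min (\<phi> p 4 + dp \<phi> 2 us 1) (\<phi> p 4 + dp \<phi> 2 us 2))"
proof -
  have d: "dp \<phi> 3 us j = dp \<phi> 2 us j" "dp \<phi> 4 us j = dp \<phi> 2 us j" for j
    by (rule dp_cap; simp)+
  have k: "key 0 0 = 0" "key 0 1 = 1" "key 0 2 = 2" "key 0 3 = 2" "key 0 4 = 2" "key 1 r = 3" "key 2 r = 4" for r
    by (simp_all add: key_def)
  have a: "(0::nat) - 2 = 0" "(1::nat) - 2 = 0" "(2::nat) - 2 = 0" "(3::nat) - 2 = 1" "(4::nat) - 2 = 2"
    "(1::nat) + 1 = 2" "(1::nat) + 2 = 3" "(2::nat) + 1 = 3" "(2::nat) + 2 = 4" by simp_all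
  show "newval \<phi> p us 0 = min (\<phi> p 0 + dp \<phi> 0 us 0) (min (\<phi> p 1 + dp \<phi> 1 us 1) (\<phi> p 2 + dp \<phi> 2 us 2))"
  "newval \<phi> p us 1 = min (\<phi> p 1 + dp \<phi> 0 us 0) (min (\<phi> p 2 + dp \<phi> 1 us 1) (\<phi> p 2 + dp \<phi> 2 us 2))"
  "newval \<phi> p us 2 = min (\<phi> p 2 + dp \<phi> 0 us 0) (min (\<phi> p 2 + dp \<phi> 1 us 1) (\<phi> p 2 + dp \<phi> 2 us 2))"
  "newval \<phi> p us 3 = min (\<phi> p 3 + dp \<phi> 1 us 0) (min (\<phi> p 3 + dp \<phi> 2 us 1) (\<phi> p 3 + dp \<phi> 2 us 2))"
  "newval \<phi> p us 4 = min (\<phi> p 4 + dp \<phi> 2 us 0) (min (\<phi> p 4 + dp \<phi> 2 us 1) (\<phi> p 4 + dp \<phi> 2 us 2))"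
    by (simp_all only: newval_def Let_def a add_0 add_0_right k d)
qed

definition tables :: "nat \<Rightarrow> (nat \<Rightarrow> nat \<Rightarrow> nat) \<Rightarrow> (nat \<Rightarrow> nat \<Rightarrow> nat) \<Rightarrow> bool" where
  "tables n \<phi> m \<longleftrightarrow> (\<forall>v<n. m 7 v = \<phi> v 0 \<and> m 8 v = \<phi> v 1 \<and> m 9 v = \<phi> v 2 \<and>
     m 10 v = \<phi> v 3 \<and> m 11 v = \<phi> v 4)"

lemma load_tables:
  assumes "tables n \<phi> m" "r x < n" "n \<le> W" "\<And>q. q \<le> 4 \<Longrightarrow> \<phi> (r x) q \<le> W" "x < 10"
  shows "\<exists>r'. sem (load_tables x) (r, m) = (r', m) \<and> safe W (load_tables x) (r, m) \<and>
    table_registers r' (\<phi> (r x)) \<and> (\<forall>y. y \<notin> {10, 11, 12, 13, 14} \<longrightarrow> r' y = r y)"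
  using assms
  by (intro exI[of _ "fst (sem (load_tables x) (r, m))"])
     (auto simp: load_tables_def tables_def table_registers_def)

lemma update_tables:
  assumes tables: "tables n \<phi> m" and p: "r 7 < n" and "n \<le> W"
    and dp: "dp_registers r \<phi> us"
    and bounds: "\<And>s j. dp \<phi> s us j \<le> K" "\<And>q. q \<le> 4 \<Longrightarrow> \<phi> (r 7) q \<le> K" "2 * K \<le> W"
  shows "\<exists>r' m'. sem update_tables (r, m) = (r', m') \<and> safe W update_tables (r, m) \<and>
    tables n (\<phi>(r 7 := newval \<phi> (r 7) us)) m' \<and> (\<forall>y<10. r' y = r y) \<and>
    (\<forall>A. A \<notin> {7, 8, 9, 10, 11} \<longrightarrow> m' A = m A)"
proof -
  have KW: "\<phi> (r 7) q \<le> W" if "q \<le> 4" for q using bounds(2)[OF that] bounds(3) by simp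
  obtain r0 where r0: "sem (load_tables 7) (r, m) = (r0, m)" "safe W (load_tables 7) (r, m)"
    "table_registers r0 (\<phi> (r 7))" "\<forall>y. y \<notin> {10, 11, 12, 13, 14} \<longrightarrow> r0 y = r y"
    using load_tables[of n \<phi> m r 7 W] tables p \<open>n \<le> W\<close> KW by auto
  let ?p = "r 7"
  have dp0: "dp_registers r0 \<phi> us" using dp r0(4) by (simp add: dp_registers_def)
  have D: "r0 q \<le> K" if "q \<in> {20, 23, 24, 26, 27, 28}" for q
    using dp0 bounds(1) that by (auto simp: dp_registers_def)
  have T: "r0 q \<le> K" if "q \<in> {10, 11, 12, 13, 14}" for q
    using r0(3) bounds(2) that by (auto simp: table_registers_def)
  have sum: "r0 q + r0 d \<le> W" if "q \<in> {10, 11, 12, 13, 14}" "d \<in> {20, 23, 24, 26, 27, 28}" for q d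
    using T[OF that(1)] D[OF that(2)] bounds(3) by simp
  \<comment> \<open>Only the temporary registers 15 to 18 change, so all five stores can be
    described by the register contents \<open>r0\<close> right after loading.\<close>
  have step: "\<exists>r'. sem (store_min_sum A a1 b1 a2 b2 a3 b3) (r1, m1) =
      (r', m1(A := (m1 A)(?p := min (r0 a1 + r0 b1) (min (r0 a2 + r0 b2) (r0 a3 + r0 b3))))) \<and>
      safe W (store_min_sum A a1 b1 a2 b2 a3 b3) (r1, m1) \<and> (\<forall>y. y \<notin> {15, 16, 17, 18} \<longrightarrow> r' y = r0 y)"
    if r1: "\<forall>y. y \<notin> {15, 16, 17, 18} \<longrightarrow> r1 y = r0 y" and "a1 \<in> {10, 11, 12, 13, 14}"
      "a2 \<in> {10, 11, 12, 13, 14}" "a3 \<in> {10, 11, 12, 13, 14}" "b1 \<in> {20, 23, 24, 26, 27, 28}"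
      "b2 \<in> {20, 23, 24, 26, 27, 28}" "b3 \<in> {20, 23, 24, 26, 27, 28}" for A a1 a2 a3 b1 b2 b3 r1 m1
  proof -
    let ?Q = "{10, 11, 12, 13, 14} \<union> {20, 23, 24, 26, 27, 28 :: nat}"
    have in_Q: "{a1, b1, a2, b2, a3, b3} \<subseteq> ?Q"
      unfolding insert_subset using that(2-) by (simp only: Un_iff simp_thms empty_subsetI)
    have disj: "?Q \<inter> {15, 16, 17, 18} = {}" by simp
    have "r1 y = r0 y" if "y \<in> {a1, b1, a2, b2, a3, b3}" for y
      using r1 subsetD[OF in_Q that] disj by (meson disjoint_iff)
    then have eq: "r1 a1 = r0 a1" "r1 b1 = r0 b1" "r1 a2 = r0 a2" "r1 b2 = r0 b2"
      "r1 a3 = r0 a3" "r1 b3 = r0 b3" by (simp_all only: insert_iff simp_thms)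
    have 7: "r1 7 = ?p" using r1 r0(4) by simp
    have sums: "r1 a1 + r1 b1 \<le> W" "r1 a2 + r1 b2 \<le> W" "r1 a3 + r1 b3 \<le> W"
      unfolding eq by (rule sum; fact)+
    have "{a1, b1, a2, b2, a3, b3} \<inter> {15, 16, 17, 18} = {}"
      using in_Q disj by (meson disjoint_iff subsetD)
    moreover have "r1 7 \<le> W" using 7 p \<open>n \<le> W\<close> by simp
    ultimately obtain r' where r': "sem (store_min_sum A a1 b1 a2 b2 a3 b3) (r1, m1) =
        (r', m1(A := (m1 A)(?p := min (r0 a1 + r0 b1) (min (r0 a2 + r0 b2) (r0 a3 + r0 b3)))))"
      "safe W (store_min_sum A a1 b1 a2 b2 a3 b3) (r1, m1)"
      "\<forall>y. y \<notin> {15, 16, 17, 18} \<longrightarrow> r' y = r1 y"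
      using store_min_sum[of a1 b1 a2 b2 a3 b3 r1 W A m1, OF _ sums] unfolding eq 7 by blast
    moreover have "\<forall>y. y \<notin> {15, 16, 17, 18} \<longrightarrow> r' y = r0 y"
      using r'(3) r1 by metis
    ultimately show ?thesis by blast
  qed
  obtain r1 m1 where 1: "sem (store_min_sum 7 10 20 11 24 12 28) (r0, m) = (r1, m1)"
    "m1 = m(7 := (m 7)(?p := min (r0 10 + r0 20) (min (r0 11 + r0 24) (r0 12 + r0 28))))"
    "safe W (store_min_sum 7 10 20 11 24 12 28) (r0, m)" "\<forall>y. y \<notin> {15, 16, 17, 18} \<longrightarrow> r1 y = r0 y"
    using step[of r0 10 11 12 20 24 28 7 m] by auto
  obtain r2 m2 where 2: "sem (store_min_sum 8 11 20 12 24 12 28) (r1, m1) = (r2, m2)"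
    "m2 = m1(8 := (m1 8)(?p := min (r0 11 + r0 20) (min (r0 12 + r0 24) (r0 12 + r0 28))))"
    "safe W (store_min_sum 8 11 20 12 24 12 28) (r1, m1)" "\<forall>y. y \<notin> {15, 16, 17, 18} \<longrightarrow> r2 y = r0 y"
    using step[of r1 11 12 12 20 24 28 8 m1] 1(4) by auto
  obtain r3 m3 where 3: "sem (store_min_sum 9 12 20 12 24 12 28) (r2, m2) = (r3, m3)"
    "m3 = m2(9 := (m2 9)(?p := min (r0 12 + r0 20) (min (r0 12 + r0 24) (r0 12 + r0 28))))"
    "safe W (store_min_sum 9 12 20 12 24 12 28) (r2, m2)" "\<forall>y. y \<notin> {15, 16, 17, 18} \<longrightarrow> r3 y = r0 y"
    using step[of r2 12 12 12 20 24 28 9 m2] 2(4) by auto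
  obtain r4 m4 where 4: "sem (store_min_sum 10 13 23 13 27 13 28) (r3, m3) = (r4, m4)"
    "m4 = m3(10 := (m3 10)(?p := min (r0 13 + r0 23) (min (r0 13 + r0 27) (r0 13 + r0 28))))"
    "safe W (store_min_sum 10 13 23 13 27 13 28) (r3, m3)" "\<forall>y. y \<notin> {15, 16, 17, 18} \<longrightarrow> r4 y = r0 y"
    using step[of r3 13 13 13 23 27 28 10 m3] 3(4) by auto
  obtain r5 m5 where 5: "sem (store_min_sum 11 14 26 14 27 14 28) (r4, m4) = (r5, m5)"
    "m5 = m4(11 := (m4 11)(?p := min (r0 14 + r0 26) (min (r0 14 + r0 27) (r0 14 + r0 28))))"
    "safe W (store_min_sum 11 14 26 14 27 14 28) (r4, m4)" "\<forall>y. y \<notin> {15, 16, 17, 18} \<longrightarrow> r5 y = r0 y"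
    using step[of r4 14 14 14 26 27 28 11 m4] 4(4) by auto
  have m5: "m5 7 = (m 7)(?p := newval \<phi> ?p us 0)" "m5 8 = (m 8)(?p := newval \<phi> ?p us 1)"
    "m5 9 = (m 9)(?p := newval \<phi> ?p us 2)" "m5 10 = (m 10)(?p := newval \<phi> ?p us 3)"
    "m5 11 = (m 11)(?p := newval \<phi> ?p us 4)"
    unfolding newval_entries using dp0 r0(3)
    by (simp_all add: 1(2) 2(2) 3(2) 4(2) 5(2) dp_registers_def table_registers_def
        del: One_nat_def)
  show ?thesis
  proof (intro exI[of _ r5] exI[of _ m5] conjI allI impI)
    show "sem update_tables (r, m) = (r5, m5)" "safe W update_tables (r, m)"
      by (simp_all add: update_tables_def r0(1,2) 1(1,3) 2(1,3) 3(1,3) 4(1,3) 5(1,3))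
    show "r5 y = r y" if "y < 10" for y using that 5(4) r0(4) by simp
    show "m5 A = m A" if "A \<notin> {7, 8, 9, 10, 11}" for A
      using that by (auto simp: 1(2) 2(2) 3(2) 4(2) 5(2))
    show "tables n (\<phi>(?p := newval \<phi> ?p us)) m5"
      using tables by (simp add: tables_def m5)
  qed
qed

section \<open>The program on a single block\<close>

definition flags :: "nat \<Rightarrow> nat set \<Rightarrow> (nat \<Rightarrow> nat \<Rightarrow> nat) \<Rightarrow> bool" where
  "flags n F m \<longleftrightarrow> (\<forall>v<n. m 12 v = (if v \<in> F then 1 else 0))"

definition input :: "nat \<Rightarrow> nat list list \<Rightarrow> nat list \<Rightarrow> (nat \<Rightarrow> nat) \<Rightarrow> (nat \<Rightarrow> nat \<Rightarrow> nat) \<Rightarrow> bool" where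
  "input n B ys r m \<longleftrightarrow> r 0 = n \<and> r 2 = length ys \<and>
     m 2 = array_of (row_offsets B) \<and> m 3 = array_of (concat B) \<and> m 6 = array_of ys"

abbreviation offset :: "nat list list \<Rightarrow> nat \<Rightarrow> nat" where
  "offset B i \<equiv> length (concat (take i B))"

lemma array_of_row_offsets: "i \<le> length B \<Longrightarrow> array_of (row_offsets B) i = offset B i"
  by (simp add: array_of_def row_offsets_def del: upt_Suc)

lemma offset_Suc: "i < length B \<Longrightarrow> offset B (Suc i) = offset B i + length (B ! i)"
  by (simp add: take_Suc_conv_app_nth)

lemma offset_le: "offset B i \<le> length (concat B)"
  by (metis append_take_drop_id concat_append le_add1 length_append)

lemma array_of_concat:
  assumes "i < length B" "t < length (B ! i)"
  shows "array_of (concat B) (offset B i + t) = B ! i ! t"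
proof -
  have "concat B = concat (take i B) @ B ! i @ concat (drop (Suc i) B)"
    using id_take_nth_drop[OF assms(1)] by (metis concat.simps(2) concat_append)
  then show ?thesis using assms(2) by (simp add: array_of_def nth_append)
qed

lemma cost_seqs_simps: "cost relax_dp = 85" "cost (load_tables x) = 6" "cost update_tables = 57"
  by (simp_all add: relax_dp_def relax_row_def cost_min_sum load_tables_def update_tables_def
      store_min_sum_def)

text \<open>\<open>K\<close> bounds the tables of the row and all \<open>dp\<close> values, the
  summand 2 being the penalty. The program only adds two such numbers, whence
  \<open>2 * K \<le> W\<close>.\<close>

locale block_step =
  fixes n W K i :: nat and B :: "nat list list" and ys :: "nat list" and row :: "nat list"
    and F :: "nat set" and \<phi> :: "nat \<Rightarrow> nat \<Rightarrow> nat"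
  assumes i: "i < length B" and row: "B ! i = row" "row \<noteq> []" "distinct row" "set row \<subseteq> {..<n}"
    and W: "length B \<le> W" "n + length B \<le> W" "length (concat B) \<le> W" "2 * K \<le> W" "2 \<le> K"
    and K: "2 + (\<Sum>v\<leftarrow>row. bound \<phi> v) \<le> K"
begin

definition context_at :: "nat \<Rightarrow> nat \<Rightarrow> (nat \<Rightarrow> nat) \<Rightarrow> (nat \<Rightarrow> nat \<Rightarrow> nat) \<Rightarrow> bool" where
  "context_at k t r m \<longleftrightarrow> input n B ys r m \<and> tables n \<phi> m \<and> flags n F m \<and> r 3 = k \<and>
     r 5 = offset B i + t \<and> r 6 = offset B i + length row \<and> r 9 = offset B i"

lemma W_ge: "2 \<le> W" "n \<le> W" "offset B i + length row \<le> W"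
  using W offset_le[of "Suc i" B] i row(1) by (auto simp: offset_Suc)

lemma load_row:
  assumes "context_at k t r m" "t < length row"
  shows "m 3 (r 5) = row ! t" "row ! t < n" "r 5 < r 6" "r 5 \<le> W" "Suc (r 5) \<le> W"
    "row ! t \<in> set row"
proof -
  have "row ! t \<in> set row" using assms by simp
  then show "row ! t < n" "row ! t \<in> set row" using row(4) by auto
  show "m 3 (r 5) = row ! t"
    using assms array_of_concat[OF i] row(1) by (simp add: context_at_def input_def)
  show "r 5 < r 6" "r 5 \<le> W" "Suc (r 5) \<le> W"
    using assms W_ge(3) by (auto simp: context_at_def)
qed

lemma bound_le_K:
  assumes "v \<in> set row" "q \<le> 4"
  shows "\<phi> v q \<le> K"
proof -
  have "bound \<phi> v \<le> (\<Sum>v\<leftarrow>row. bound \<phi> v)"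
    using assms(1) by (intro member_le_sum_list) auto
  then show ?thesis using bound_ge[OF assms(2), of \<phi> v] K by simp
qed

lemma dp_le_K:
  assumes "distinct us" "set us \<subseteq> set row"
  shows "dp \<phi> s us j \<le> K"
proof -
  have "(\<Sum>u\<leftarrow>us. bound \<phi> u) \<le> (\<Sum>v\<leftarrow>row. bound \<phi> v)"
    using assms row(3) by (simp add: sum_list_distinct_conv_sum_set sum_mono2)
  then show ?thesis using dp_bound[of \<phi> s us j] K by (auto split: if_splits)
qed

lemma runs_find_row:
  assumes "input n B ys r m" "tables n \<phi> m" "flags n F m" "r 3 = k" "r 4 = n + i"
  shows "runs W find_row (r, m) 10 (\<lambda>(r, m). context_at k 0 r m \<and> r 7 = hd row)"
proof -
  have "array_of (row_offsets B) i = offset B i"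
    "array_of (row_offsets B) (Suc i) = offset B i + length row"
    using i row(1) by (simp_all add: array_of_row_offsets offset_Suc)
  moreover have "array_of (concat B) (offset B i) = hd row"
    using array_of_concat[OF i, of 0] row by (simp add: hd_conv_nth)
  moreover have "hd row \<le> W" using row(2,4) W_ge(2) by (cases row) auto
  ultimately show ?thesis
    using assms i W W_ge
    by (intro runs_straight) (auto simp: find_row_def context_at_def input_def)
qed

lemma runs_find_parent:
  assumes "context_at k 0 r m" "r 7 = hd row"
  shows "runs W find_parent (r, m) (11 * length row + 1)
    (\<lambda>(r, m). context_at k (length row) r m \<and> r 7 = pick F row)"
proof -
  let ?f = "\<lambda>p v. if v \<in> F then v else p"
  define I where "I = (\<lambda>t (r :: nat \<Rightarrow> nat, m). context_at k t r m \<and> r 7 = foldl ?f (hd row) (take t row))"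
  have "runs W find_parent (r, m) ((\<Sum>t<length row. 10 + 1) + 1) (I (length row))"
    unfolding find_parent_def
  proof (rule runs_While)
    show "I 0 (r, m)" using assms by (simp add: I_def)
    show "\<not> test_val (fst s) (Less (Reg 5) (Reg 6))" if "I (length row) s" for s
      using that by (cases s) (auto simp: I_def context_at_def)
  next
    fix t s assume t: "t < length row" and I: "I t s"
    obtain r m where s: "s = (r, m)" by (cases s)
    have c: "context_at k t r m" and r7: "r 7 = foldl ?f (hd row) (take t row)"
      using I by (auto simp: I_def s)
    note l = load_row[OF c t]
    have m12: "m 12 (row ! t) = (if row ! t \<in> F then 1 else 0)"
      using c l(2) by (simp add: context_at_def flags_def)
    have take: "take (Suc t) row = take t row @ [row ! t]" using t by (simp add: take_Suc_conv_app_nth)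
    show "test_val (fst s) (Less (Reg 5) (Reg 6)) \<and> runs W (seqs [Load 8 3 (Reg 5),
        Load 10 12 (Reg 8), Cond (Equal (Reg 10) (Const 1)) (Move 7 (Reg 8)) Skip,
        Add 5 (Reg 5) (Const 1)]) s 10 (I (Suc t))"
      using c l m12 W_ge r7
      by (auto simp: s I_def take context_at_def input_def intro!: runs_straight)
  qed
  then show ?thesis by (rule runs_mono) (auto simp: I_def pick_def)
qed

lemma runs_init_dp:
  assumes "context_at k t r m" "r 7 = p"
  shows "runs W init_dp (r, m) 15 (\<lambda>(r, m). context_at k 0 r m \<and> r 7 = p \<and> dp_registers r \<phi> [])"
  using assms W_ge
  by (intro runs_straight) (auto simp: init_dp_def context_at_def input_def dp_registers_def)

lemma runs_compute_dp:
  assumes "context_at k 0 r m" "r 7 = p" "dp_registers r \<phi> []"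
  shows "runs W compute_dp (r, m) (101 * length row + 1)
    (\<lambda>(r, m). context_at k (length row) r m \<and> r 7 = p \<and>
       dp_registers r \<phi> (rev (filter (\<lambda>v. v \<noteq> p) row)))"
proof -
  let ?us = "\<lambda>t. rev (filter (\<lambda>v. v \<noteq> p) (take t row))"
  define I where "I = (\<lambda>t (r :: nat \<Rightarrow> nat, m). context_at k t r m \<and> r 7 = p \<and> dp_registers r \<phi> (?us t))"
  have "runs W compute_dp (r, m) ((\<Sum>t<length row. 100 + 1) + 1) (I (length row))"
    unfolding compute_dp_def
  proof (rule runs_While)
    show "I 0 (r, m)" using assms by (simp add: I_def)
    show "\<not> test_val (fst s) (Less (Reg 5) (Reg 6))" if "I (length row) s" for s
      using that by (cases s) (auto simp: I_def context_at_def)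
  next
    fix t s assume t: "t < length row" and I: "I t s"
    obtain r m where s: "s = (r, m)" by (cases s)
    have c: "context_at k t r m" and r7: "r 7 = p" and d: "dp_registers r \<phi> (?us t)"
      using I by (auto simp: I_def s)
    note l = load_row[OF c t]
    let ?v = "row ! t"
    have take: "take (Suc t) row = take t row @ [?v]" using t by (simp add: take_Suc_conv_app_nth)
    have "runs W (seqs [Load 8 3 (Reg 5),
        Cond (Equal (Reg 8) (Reg 7)) Skip (Seq (load_tables 8) relax_dp),
        Add 5 (Reg 5) (Const 1)]) s 100 (I (Suc t))"
    proof (cases "?v = p")
      case True
      then have "?us (Suc t) = ?us t" by (simp add: take)
      then have "I (Suc t) (r(8 := p, 5 := Suc (r 5)), m)"
        using c r7 d by (simp add: I_def context_at_def input_def dp_registers_def)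
      moreover have "p \<le> W" using True l(2) W_ge(2) by simp
      ultimately show ?thesis
        using True l(1,4,5) r7 unfolding s
        by (intro runs_straight) (simp_all add: cost_seqs_simps)
    next
      case False
      let ?r = "r(8 := ?v)"
      have KW: "\<phi> ?v q \<le> W" if "q \<le> 4" for q using bound_le_K[OF l(6) that] W(4) by simp
      obtain r1 where r1: "sem (load_tables 8) (?r, m) = (r1, m)" "safe W (load_tables 8) (?r, m)"
        "table_registers r1 (\<phi> ?v)" "\<forall>y. y \<notin> {10, 11, 12, 13, 14} \<longrightarrow> r1 y = ?r y"
        using load_tables[of n \<phi> m ?r 8 W] c l(2) W_ge(2) KW by (auto simp: context_at_def)
      have "dp_registers r1 \<phi> (?us t)" using d r1(4) by (simp add: dp_registers_def)
      moreover have "dp \<phi> s' (?us t) j \<le> K" for s' j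
        using row(3) by (intro dp_le_K) (auto dest: in_set_takeD)
      ultimately obtain r2 where r2: "sem relax_dp (r1, m) = (r2, m)" "safe W relax_dp (r1, m)"
        "dp_registers r2 \<phi> (?v # ?us t)" "\<forall>y<10. r2 y = r1 y"
        using relax_dp[of r1 \<phi> "?us t" ?v K W m] r1(3) bound_le_K[OF l(6)] W(4) by blast
      have r2_eq: "r2 y = r y" if "y \<in> {0, 2, 3, 5, 6, 7, 9}" for y
        using that r2(4) r1(4) by auto
      have "?us (Suc t) = ?v # ?us t" using False by (simp add: take)
      then have "I (Suc t) (r2(5 := Suc (r 5)), m)"
        using c r7 r2(3) r2_eq
        by (simp add: I_def context_at_def input_def dp_registers_def)
      moreover have "?v \<le> W" using l(2) W_ge(2) by simp
      ultimately show ?thesis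
        using False r7 l(1,4,5) r1(1,2) r2(1,2) r2_eq[of 5] unfolding s
        by (intro runs_straight) (simp_all add: cost_seqs_simps)
    qed
    then show "test_val (fst s) (Less (Reg 5) (Reg 6)) \<and> runs W (seqs [Load 8 3 (Reg 5),
        Cond (Equal (Reg 8) (Reg 7)) Skip (Seq (load_tables 8) relax_dp),
        Add 5 (Reg 5) (Const 1)]) s 100 (I (Suc t))"
      using l(3) by (simp add: s)
  qed
  then show ?thesis by (rule runs_mono) (auto simp: I_def)
qed

lemma runs_eliminate_block:
  assumes "input n B ys r m" "tables n \<phi> m" "flags n F m" "r 3 = k" "r 4 = n + i"
  defines "p \<equiv> pick F row"
  shows "runs W eliminate_block (r, m) (112 * length row + 84)
    (\<lambda>(r, m). input n B ys r m \<and> flags n F m \<and> r 3 = k \<and> r 7 = p \<and>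
       tables n (\<phi>(p := newval \<phi> p (rev (filter (\<lambda>v. v \<noteq> p) row)))) m)"
proof -
  let ?us = "rev (filter (\<lambda>v. v \<noteq> p) row)"
  have p: "p \<in> set row" "p < n" using pick_in_row[OF row(2), of F] row(4) by (auto simp: p_def)
  have update: "runs W update_tables (r, m) 57
      (\<lambda>(r, m). input n B ys r m \<and> flags n F m \<and> r 3 = k \<and> r 7 = p \<and>
         tables n (\<phi>(p := newval \<phi> p ?us)) m)"
    if c: "context_at k (length row) r m" "r 7 = p" "dp_registers r \<phi> ?us" for r m
  proof -
    have "dp \<phi> s' ?us j \<le> K" for s' j using row(3) by (intro dp_le_K) auto
    then obtain r' m' where "sem update_tables (r, m) = (r', m')" "safe W update_tables (r, m)"
      "tables n (\<phi>(r 7 := newval \<phi> (r 7) ?us)) m'" "\<forall>y<10. r' y = r y"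
      "\<forall>A. A \<notin> {7, 8, 9, 10, 11} \<longrightarrow> m' A = m A"
      using update_tables[of n \<phi> m r W ?us K] c p bound_le_K[OF p(1)] W(4) W_ge(2)
      by (auto simp: context_at_def)
    then show ?thesis
      using c by (intro runs_straight)
        (auto simp: cost_seqs_simps context_at_def input_def flags_def)
  qed
  have "runs W eliminate_block (r, m) (10 + ((11 * length row + 1) + (15 + ((101 * length row + 1) + 57))))
      (\<lambda>(r, m). input n B ys r m \<and> flags n F m \<and> r 3 = k \<and> r 7 = p \<and>
         tables n (\<phi>(p := newval \<phi> p ?us)) m)"
    unfolding eliminate_block_def
  proof (intro runs_Seq)
    show "runs W find_row (r, m) 10 (\<lambda>(r, m). context_at k 0 r m \<and> r 7 = hd row)"
      using assms by (intro runs_find_row)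
    show "runs W find_parent s (11 * length row + 1)
        (\<lambda>(r, m). context_at k (length row) r m \<and> r 7 = p)"
      if "case s of (r, m) \<Rightarrow> context_at k 0 r m \<and> r 7 = hd row" for s
      using that runs_find_parent by (auto simp: p_def)
    show "runs W init_dp s 15
        (\<lambda>(r, m). context_at k 0 r m \<and> r 7 = p \<and> dp_registers r \<phi> [])"
      if "case s of (r, m) \<Rightarrow> context_at k (length row) r m \<and> r 7 = p" for s
      using that runs_init_dp by auto
    show "runs W compute_dp s (101 * length row + 1)
        (\<lambda>(r, m). context_at k (length row) r m \<and> r 7 = p \<and> dp_registers r \<phi> ?us)"
      if "case s of (r, m) \<Rightarrow> context_at k 0 r m \<and> r 7 = p \<and> dp_registers r \<phi> []" for s
      using that runs_compute_dp by auto
    show "runs W update_tables s 57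
        (\<lambda>(r, m). input n B ys r m \<and> flags n F m \<and> r 3 = k \<and> r 7 = p \<and>
           tables n (\<phi>(p := newval \<phi> p ?us)) m)"
      if "case s of (r, m) \<Rightarrow> context_at k (length row) r m \<and> r 7 = p \<and> dp_registers r \<phi> ?us" for s
      using that update by auto
  qed
  then show ?thesis by (rule runs_mono) auto
qed

end

section \<open>The program as a whole\<close>

locale block_run = block_order +
  fixes W :: nat
  assumes W: "length (concat B) \<le> W" "4 + 4 * n \<le> W"
begin

lemma runs_init_tables:
  assumes "input n B ys r m"
  shows "runs W init_tables (r, m) (8 * n + 2)
    (\<lambda>(r, m'). input n B ys r m' \<and> tables n init_cost m' \<and> m' 12 = m 12)"
proof -
  define I where "I = (\<lambda>k (r :: nat \<Rightarrow> nat, m'). input n B ys r m' \<and> r 3 = k \<and> m' 12 = m 12 \<and>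
    (\<forall>v<k. m' 7 v = 2 \<and> m' 8 v = 2 \<and> m' 9 v = 0 \<and> m' 10 v = 1 \<and> m' 11 v = (2 :: nat)))"
  have "runs W init_tables (r, m) (1 + ((\<Sum>k<n. 7 + 1) + 1)) (I n)"
    unfolding init_tables_def
  proof (rule runs_Seq)
    show "runs W (Move 3 (Const 0)) (r, m) 1 (I 0)"
      using assms by (intro runs_straight) (simp_all add: I_def input_def)
  next
    fix s assume "I 0 s"
    then show "runs W (While (Less (Reg 3) (Reg 0)) (seqs
        [Store 7 (Reg 3) (Const 2), Store 8 (Reg 3) (Const 2), Store 9 (Reg 3) (Const 0),
         Store 10 (Reg 3) (Const 1), Store 11 (Reg 3) (Const 2), Add 3 (Reg 3) (Const 1)]))
        s ((\<Sum>k<n. 7 + 1) + 1) (I n)"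
    proof (rule runs_While)
      show "\<not> test_val (fst s) (Less (Reg 3) (Reg 0))" if "I n s" for s
        using that by (cases s) (simp add: I_def input_def)
    next
      fix k s assume k: "k < n" and I: "I k s"
      obtain r m1 where s: "s = (r, m1)" by (cases s)
      have "test_val (fst s) (Less (Reg 3) (Reg 0))"
        using I k by (simp add: s I_def input_def)
      moreover have "k \<le> W" "Suc k \<le> W" "2 \<le> W" using k W by auto
      ultimately show "test_val (fst s) (Less (Reg 3) (Reg 0)) \<and> runs W (seqs
        [Store 7 (Reg 3) (Const 2), Store 8 (Reg 3) (Const 2), Store 9 (Reg 3) (Const 0),
         Store 10 (Reg 3) (Const 1), Store 11 (Reg 3) (Const 2), Add 3 (Reg 3) (Const 1)])
        s 7 (I (Suc k))"
        using I unfolding s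
        by (intro conjI runs_straight) (simp_all add: I_def input_def less_Suc_eq)
    qed
  qed
  then show ?thesis
    by (rule runs_mono) (auto simp: I_def tables_def init_cost_def)
qed

lemma runs_init_flags:
  assumes "input n B ys r m" "tables n \<phi> m" "\<forall>v<n. m 12 v = 0"
  shows "runs W init_flags (r, m) (5 * length ys + 2)
    (\<lambda>(r, m). input n B ys r m \<and> tables n \<phi> m \<and> flags n (set ys) m)"
proof -
  define I where "I = (\<lambda>k (r :: nat \<Rightarrow> nat, m). input n B ys r m \<and> r 3 = k \<and> tables n \<phi> m \<and>
    flags n (set (take k ys)) m)"
  have "runs W init_flags (r, m) (1 + ((\<Sum>k<length ys. 4 + 1) + 1)) (I (length ys))"
    unfolding init_flags_def
  proof (rule runs_Seq)
    show "runs W (Move 3 (Const 0)) (r, m) 1 (I 0)"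
      using assms by (intro runs_straight) (simp_all add: I_def input_def flags_def)
  next
    fix s assume "I 0 s"
    then show "runs W (While (Less (Reg 3) (Reg 2)) (seqs
        [Load 4 6 (Reg 3), Store 12 (Reg 4) (Const 1), Add 3 (Reg 3) (Const 1)]))
        s ((\<Sum>k<length ys. 4 + 1) + 1) (I (length ys))"
    proof (rule runs_While)
      show "\<not> test_val (fst s) (Less (Reg 3) (Reg 2))" if "I (length ys) s" for s
        using that by (cases s) (simp add: I_def input_def)
    next
      fix k s assume k: "k < length ys" and I: "I k s"
      obtain r m where s: "s = (r, m)" by (cases s)
      have "test_val (fst s) (Less (Reg 3) (Reg 2))"
        using I k by (simp add: s I_def input_def)
      moreover have "k \<le> W" "Suc k \<le> W" "1 \<le> W" using k W length_ys by auto
      moreover have "ys ! k \<le> W" using ys_less[of "ys ! k"] k W by simp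
      moreover have "array_of ys k = ys ! k" using k by (simp add: array_of_def)
      moreover have "set (take (Suc k) ys) = insert (ys ! k) (set (take k ys))"
        using k by (simp add: take_Suc_conv_app_nth)
      ultimately show "test_val (fst s) (Less (Reg 3) (Reg 2)) \<and> runs W (seqs
        [Load 4 6 (Reg 3), Store 12 (Reg 4) (Const 1), Add 3 (Reg 3) (Const 1)])
        s 4 (I (Suc k))"
        using I unfolding s
        by (intro conjI runs_straight) (simp_all add: I_def input_def tables_def flags_def)
    qed
  qed
  then show ?thesis
    by (rule runs_mono) (auto simp: I_def)
qed

text \<open>The current tables and the remaining eliminations lead to the same final tables as the
  initial ones with all eliminations. The bound on the sum is the potential that controls the word
  size.\<close>

definition invariant :: "nat \<Rightarrow> (nat \<Rightarrow> nat) \<Rightarrow> (nat \<Rightarrow> nat \<Rightarrow> nat) \<Rightarrow> bool" where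
  "invariant k r m \<longleftrightarrow> (\<exists>U \<phi>. input n B ys r m \<and> r 3 = k \<and> flags n (set (drop k ys)) m \<and>
     tables n \<phi> m \<and> finite U \<and> elimination U last_vertex (elim_steps n B (drop k ys)) \<and>
     solve \<phi> (elim_steps n B (drop k ys)) = solve init_cost (elim_steps n B ys) \<and>
     sum (bound \<phi>) U \<le> 2 * n \<and>
     (elim_steps n B (drop k ys) = [] \<longrightarrow> r 7 = last_vertex))"

lemma runs_main_body:
  assumes inv: "invariant k r m" and k: "k < length ys"
  defines "c \<equiv> if n \<le> ys ! k then 112 * length (B ! (ys ! k - n)) else 0"
  shows "runs W (Seq (seqs [Load 4 6 (Reg 3), Store 12 (Reg 4) (Const 0)])
      (Seq (Cond (Less (Reg 4) (Reg 0)) Skip eliminate_block) (Add 3 (Reg 3) (Const 1))))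
    (r, m) (89 + c) (\<lambda>(r, m). invariant (Suc k) r m)"
proof -
  define y zs where "y = ys ! k" and "zs = drop (Suc k) ys"
  have drop: "drop k ys = y # zs" using k by (simp add: y_def zs_def Cons_nth_drop_Suc)
  have y: "y \<in> set ys" "y \<notin> set zs" "y \<le> W"
    using k drop distinct_drop[OF distinct_ys, of k] ys_less[of y] W by (auto simp: y_def)
  obtain U \<phi> where inp: "input n B ys r m" "r 3 = k" and fl: "flags n (set (y # zs)) m"
    and tab: "tables n \<phi> m" and U: "finite U" "elimination U last_vertex (elim_steps n B (y # zs))"
    and solve: "solve \<phi> (elim_steps n B (y # zs)) = solve init_cost (elim_steps n B ys)"
    and bnd: "sum (bound \<phi>) U \<le> 2 * n"
    and r7: "elim_steps n B (y # zs) = [] \<longrightarrow> r 7 = last_vertex"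
    using inv unfolding invariant_def drop by blast
  define J where "J = (\<lambda>(r, m). input n B ys r m \<and> r 3 = k \<and> r 4 = y \<and> tables n \<phi> m \<and>
    flags n (set zs) m \<and> (elim_steps n B (y # zs) = [] \<longrightarrow> r 7 = last_vertex))"
  define J' where "J' = (\<lambda>(r, m). \<exists>U \<phi>. input n B ys r m \<and> r 3 = k \<and> flags n (set zs) m \<and>
     tables n \<phi> m \<and> finite U \<and> elimination U last_vertex (elim_steps n B zs) \<and>
     solve \<phi> (elim_steps n B zs) = solve init_cost (elim_steps n B ys) \<and>
     sum (bound \<phi>) U \<le> 2 * n \<and> (elim_steps n B zs = [] \<longrightarrow> r 7 = last_vertex))"
  have "runs W (seqs [Load 4 6 (Reg 3), Store 12 (Reg 4) (Const 0)]) (r, m) 3 J"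
  proof (rule runs_straight)
    have "array_of ys k = y" using k by (simp add: array_of_def y_def)
    moreover have "k \<le> W" using k length_ys W by simp
    moreover have "flags n (set zs) (m(12 := (m 12)(y := 0)))"
      using fl y(2) by (auto simp: flags_def)
    ultimately show "J (sem (seqs [Load 4 6 (Reg 3), Store 12 (Reg 4) (Const 0)]) (r, m))"
      and "safe W (seqs [Load 4 6 (Reg 3), Store 12 (Reg 4) (Const 0)]) (r, m)"
      using inp tab r7 y(3) by (simp_all add: J_def input_def tables_def)
  qed simp
  moreover have "runs W (Cond (Less (Reg 4) (Reg 0)) Skip eliminate_block) s (1 + (84 + c)) J'"
    if J: "J s" for s
  proof -
    obtain r m where s: "s = (r, m)" by (cases s)
    note J = J[unfolded J_def s, simplified]
    show ?thesis
    proof (rule runs_Cond)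
      assume "test_val (fst s) (Less (Reg 4) (Reg 0))"
      then have "y < n" using J by (simp add: s input_def)
      then have "elim_steps n B (y # zs) = elim_steps n B zs" by simp
      then have "J' (r, m)"
        unfolding J'_def prod.case using J U solve bnd by (intro exI[of _ U] exI[of _ \<phi>]) simp
      then show "runs W Skip s (84 + c) J'"
        unfolding s by (intro runs_straight) auto
    next
      assume "\<not> test_val (fst s) (Less (Reg 4) (Reg 0))"
      then have ny: "n \<le> y" using J by (simp add: s input_def)
      define row p where "row = B ! (y - n)" and "p = pick (set zs) row"
      define us where "us = rev (filter (\<lambda>v. v \<noteq> p) row)"
      note row = row_of[OF y(1) ny, folded row_def]
      have steps: "elim_steps n B (y # zs) = (p, us) # elim_steps n B zs"
        using ny by (simp add: row_def p_def us_def Let_def)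
      note U' = U(2)[unfolded steps]
      have p: "p \<in> set row" unfolding p_def by (rule pick_in_row[OF row(5)])
      have "set row \<subseteq> U" using U' by (auto simp: us_def)
      then have "(\<Sum>v\<leftarrow>row. bound \<phi> v) \<le> 2 * n"
        using bnd sum_mono2[OF U(1), of "set row" "bound \<phi>"] row(2)
        by (simp add: sum_list_distinct_conv_sum_set)
      \<comment> \<open>With \<open>K = 2 + 2 * n\<close>, the assumed
        \<open>4 + 4 * n \<le> W\<close> is the required \<open>2 * K \<le> W\<close>.\<close>
      then interpret block_step n W "2 + 2 * n" "y - n" B ys row "set zs" \<phi>
        using row length_B W by unfold_locales (auto simp: row_def)
      have run: "runs W eliminate_block (r, m) (112 * length row + 84)
        (\<lambda>(r, m). input n B ys r m \<and> flags n (set zs) m \<and> r 3 = k \<and> r 7 = p \<and>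
          tables n (\<phi>(p := newval \<phi> p us)) m)"
        unfolding us_def p_def using J ny by (intro runs_eliminate_block) auto
      have cost: "112 * length row + 84 \<le> 84 + c"
        using ny by (simp add: c_def row_def y_def)
      have J'I: "J' (r', m')" if post: "input n B ys r' m' \<and> flags n (set zs) m' \<and> r' 3 = k \<and>
          r' 7 = p \<and> tables n (\<phi>(p := newval \<phi> p us)) m'" for r' m'
      proof -
        \<comment> \<open>After the last elimination only the survivor is left, and \<open>p\<close>
          is left too.\<close>
        have "r' 7 = last_vertex" if "elim_steps n B zs = []"
          using U' that post by auto
        then show ?thesis
          unfolding J'_def prod.case
          using post U(1) U' solve[unfolded steps] bnd sum_bound_elimination[OF U(1) U', of \<phi>]
          by (intro exI[of _ "U - set us"] exI[of _ "\<phi>(p := newval \<phi> p us)"]) auto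
      qed
      show "runs W eliminate_block s (84 + c) J'"
        unfolding s
      proof (rule runs_mono[OF run cost])
        fix s' assume "case s' of (r', m') \<Rightarrow> input n B ys r' m' \<and> flags n (set zs) m' \<and> r' 3 = k \<and>
          r' 7 = p \<and> tables n (\<phi>(p := newval \<phi> p us)) m'"
        then show "J' s'" by (cases s') (simp add: J'I)
      qed
    qed
  qed
  moreover have "runs W (Add 3 (Reg 3) (Const 1)) s 1 (\<lambda>(r, m). invariant (Suc k) r m)"
    if J': "J' s" for s
  proof -
    obtain r m where s: "s = (r, m)" by (cases s)
    obtain U \<phi> where *: "input n B ys r m" "r 3 = k" "flags n (set zs) m" "tables n \<phi> m" "finite U"
      "elimination U last_vertex (elim_steps n B zs)"
      "solve \<phi> (elim_steps n B zs) = solve init_cost (elim_steps n B ys)"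
      "sum (bound \<phi>) U \<le> 2 * n" "elim_steps n B zs = [] \<longrightarrow> r 7 = last_vertex"
      using J' unfolding J'_def s prod.case by blast
    have "input n B ys (r(3 := Suc k)) m" using *(1) by (simp add: input_def)
    then have "invariant (Suc k) (r(3 := Suc k)) m"
      unfolding invariant_def zs_def[symmetric] using * by (intro exI[of _ U] exI[of _ \<phi>]) simp
    moreover have "Suc k \<le> W" using k length_ys W by simp
    ultimately show ?thesis
      unfolding s using *(2) by (intro runs_straight) simp_all
  qed
  ultimately have "runs W (Seq (seqs [Load 4 6 (Reg 3), Store 12 (Reg 4) (Const 0)])
      (Seq (Cond (Less (Reg 4) (Reg 0)) Skip eliminate_block) (Add 3 (Reg 3) (Const 1))))
    (r, m) (3 + ((1 + (84 + c)) + 1)) (\<lambda>(r, m). invariant (Suc k) r m)"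
    by (intro runs_Seq)
  then show ?thesis by (rule runs_mono) auto
qed

lemma runs_main_loop:
  assumes "input n B ys r m" "tables n init_cost m" "flags n (set ys) m"
  shows "runs W main_loop (r, m) (404 * n + 2) (\<lambda>(r, m). invariant (length ys) r m)"
proof -
  let ?c = "\<lambda>y. if n \<le> y then 112 * length (B ! (y - n)) else 0"
  have bnd: "sum (bound init_cost) {..<n} \<le> 2 * n" by (simp add: bound_init_cost)
  have "runs W main_loop (r, m) (1 + ((\<Sum>k<length ys. (89 + ?c (ys ! k)) + 1) + 1))
      (\<lambda>(r, m). invariant (length ys) r m)"
    unfolding main_loop_def
  proof (rule runs_Seq)
    have "invariant 0 (r(3 := 0)) m"
      unfolding invariant_def using assms elimination_ys bnd elim_steps_nonempty
      by (intro exI[of _ "{..<n}"] exI[of _ init_cost]) (simp add: input_def)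
    then show "runs W (Move 3 (Const 0)) (r, m) 1 (\<lambda>(r, m). invariant 0 r m)"
      by (intro runs_straight) simp_all
  next
    fix s assume I0: "case s of (r, m) \<Rightarrow> invariant 0 r m"
    show "runs W (While (Less (Reg 3) (Reg 2))
      (Seq (seqs [Load 4 6 (Reg 3), Store 12 (Reg 4) (Const 0)])
       (Seq (Cond (Less (Reg 4) (Reg 0)) Skip eliminate_block) (Add 3 (Reg 3) (Const 1)))))
      s ((\<Sum>k<length ys. (89 + ?c (ys ! k)) + 1) + 1) (\<lambda>(r, m). invariant (length ys) r m)"
    proof (rule runs_While[where I = "\<lambda>k (r, m). invariant k r m"])
      show "case s of (r, m) \<Rightarrow> invariant 0 r m" by (rule I0)
      show "\<not> test_val (fst s) (Less (Reg 3) (Reg 2))"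
        if "case s of (r, m) \<Rightarrow> invariant (length ys) r m" for s
        using that by (auto simp: invariant_def input_def split: prod.splits)
    next
      fix k s assume k: "k < length ys" and I: "case s of (r, m) \<Rightarrow> invariant k r m"
      obtain r m where s: "s = (r, m)" by (cases s)
      have I: "invariant k r m" using I s by simp
      then have "test_val (fst s) (Less (Reg 3) (Reg 2))"
        using k by (auto simp: s invariant_def input_def)
      with runs_main_body[OF I k] show "test_val (fst s) (Less (Reg 3) (Reg 2)) \<and> runs W
        (Seq (seqs [Load 4 6 (Reg 3), Store 12 (Reg 4) (Const 0)])
         (Seq (Cond (Less (Reg 4) (Reg 0)) Skip eliminate_block) (Add 3 (Reg 3) (Const 1))))
        s (89 + ?c (ys ! k)) (\<lambda>(r, m). invariant (Suc k) r m)"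
        unfolding s by blast
    qed
  qed
  moreover have "1 + ((\<Sum>k<length ys. (89 + ?c (ys ! k)) + 1) + 1) \<le> 404 * n + 2"
  proof -
    \<comment> \<open>There are at most 2 n items, and the rows have at most 2 n entries in all: 90
      * 2 n + 112 * 2 n = 404 n.\<close>
    have "(\<Sum>k<length ys. (89 + ?c (ys ! k)) + 1) = 90 * length ys + (\<Sum>k<length ys. ?c (ys ! k))"
      by (simp add: sum.distrib)
    also have "(\<Sum>k<length ys. ?c (ys ! k)) =
        112 * (\<Sum>y\<leftarrow>ys. if n \<le> y then length (B ! (y - n)) else 0)"
      by (simp add: sum_list_sum_nth sum_distrib_left atLeast0LessThan if_distrib cong: if_cong)
    finally show ?thesis using sum_rows_ys length_ys by simp
  qed
  ultimately show ?thesis by (rule runs_mono) auto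
qed

lemma runs_read_result:
  assumes "invariant (length ys) r m"
  shows "runs W read_result (r, m) 14
    (\<lambda>(r, m). r 0 = opt {..<n} (elim_steps n B ys) init_cost)"
proof -
  obtain U \<phi> where *: "input n B ys r m" "tables n \<phi> m" "finite U" "elimination U last_vertex []"
    "\<phi> = solve init_cost (elim_steps n B ys)" "sum (bound \<phi>) U \<le> 2 * n" "r 7 = last_vertex"
    using assms by (auto simp: invariant_def)
  have le: "\<phi> (r 7) q \<le> W" if "q \<le> 4" for q
    using bound_ge[OF that, of \<phi> "r 7"] *(4,6,7) W by simp
  have "n \<le> W" using W by simp
  then obtain r' where r': "sem (load_tables 7) (r, m) = (r', m)" "safe W (load_tables 7) (r, m)"
    "table_registers r' (\<phi> last_vertex)"
    using load_tables[of n \<phi> m r 7 W] *(2,7) last_vertex_less le by auto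
  have opt: "opt {..<n} (elim_steps n B ys) init_cost =
      min (\<phi> last_vertex 0) (min (\<phi> last_vertex 3) (\<phi> last_vertex 4))"
    unfolding *(5) by (rule opt_solve[OF _ elimination_ys]) (auto intro: regular_init_cost)
  show ?thesis
  proof (rule runs_straight)
    show "safe W read_result (r, m)"
      using r' le *(7) by (auto simp: read_result_def table_registers_def)
    show "case sem read_result (r, m) of (r, m) \<Rightarrow> r 0 = opt {..<n} (elim_steps n B ys) init_cost"
      using r' unfolding opt by (auto simp: read_result_def table_registers_def min_def)
    show "cost read_result \<le> 14" by (simp add: read_result_def cost_seqs_simps)
  qed
qed

lemma runs_roman2_program:
  assumes "input n B ys r m" "\<forall>v<n. m 12 v = 0"
  shows "runs W roman2_program (r, m) (500 * n)
    (\<lambda>(r, m). r 0 = opt {..<n} (elim_steps n B ys) init_cost)"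
proof -
  have "runs W roman2_program (r, m) ((8 * n + 2) + ((5 * length ys + 2) + ((404 * n + 2) + 14)))
    (\<lambda>(r, m). r 0 = opt {..<n} (elim_steps n B ys) init_cost)"
    unfolding roman2_program_def
  proof (intro runs_Seq)
    show "runs W init_tables (r, m) (8 * n + 2)
        (\<lambda>(r, m'). input n B ys r m' \<and> tables n init_cost m' \<and> (\<forall>v<n. m' 12 v = 0))"
      by (rule runs_mono[OF runs_init_tables[OF assms(1)]]) (use assms(2) in auto)
    show "runs W init_flags s (5 * length ys + 2)
        (\<lambda>(r, m). input n B ys r m \<and> tables n init_cost m \<and> flags n (set ys) m)"
      if "case s of (r, m') \<Rightarrow> input n B ys r m' \<and> tables n init_cost m' \<and> (\<forall>v<n. m' 12 v = 0)" for s
      using that runs_init_flags by (cases s) simp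
    show "runs W main_loop s (404 * n + 2) (\<lambda>(r, m). invariant (length ys) r m)"
      if "case s of (r, m) \<Rightarrow> input n B ys r m \<and> tables n init_cost m \<and> flags n (set ys) m" for s
      using that runs_main_loop by (cases s) simp
    show "runs W read_result s 14 (\<lambda>(r, m). r 0 = opt {..<n} (elim_steps n B ys) init_cost)"
      if "case s of (r, m) \<Rightarrow> invariant (length ys) r m" for s
      using that runs_read_result by (cases s) simp
  qed
  \<comment> \<open>The sum is at most 422 n + 20, and \<open>n\<close> is positive.\<close>
  then show ?thesis by (rule runs_mono) (use length_ys n_pos in auto)
qed

end

section \<open>Block graphs with a tree ordering\<close>

lemma length_concat_le:
  assumes "\<And>b. b \<in> set B \<Longrightarrow> length b \<le> n"
  shows "length (concat B) \<le> length B * n"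
  using assms by (induct B) (auto intro: add_mono)

lemma bc_code_block:
  assumes "distinct (map set B)" "i < length B"
  shows "bc_code n B (Inr (set (B ! i))) = n + i"
proof -
  have "(THE k. k < length B \<and> set (B ! k) = set (B ! i)) = i"
    using assms nth_eq_iff_index_eq[OF assms(1)] by (intro the_equality) auto
  then show ?thesis by simp
qed

locale tree_ordered_block_graph = G: graph G for G :: "(nat, 'b) pre_digraph" +
  fixes n :: nat and B :: "nat list list" and xs :: "(nat + nat set) list"
  assumes verts: "verts G = {..<n}" and n: "2 \<le> n"
    and connected: "Digraph_Component.connected G" and block_graph: "block_graph G"
    and B: "block_lists G B" and xs: "tree_ordering (block_cutpoint_graph G) xs"
begin

abbreviation "code \<equiv> bc_code n B"

lemma blocks_B: "set ` set B = blocks G"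
  using B by (simp add: block_lists_def)

lemma block_nth: "i < length B \<Longrightarrow> set (B ! i) \<in> blocks G"
  using blocks_B by (metis image_eqI nth_mem)

lemma block_index:
  assumes "S \<in> blocks G"
  obtains i where "i < length B" "set (B ! i) = S" "code (Inr S) = n + i"
proof -
  have "S \<in> set ` set B" using assms blocks_B by simp
  then obtain b where "b \<in> set B" "set b = S" by blast
  then obtain i where i: "i < length B" "set (B ! i) = S" by (auto simp: in_set_conv_nth)
  moreover have "code (Inr (set (B ! i))) = n + i"
    using B i(1) by (intro bc_code_block) (simp_all add: block_lists_def)
  ultimately show ?thesis using that by blast
qed

lemma items:
  "set xs = Inl ` {v. cut_vertex G v} \<union> Inr ` blocks G"
  using xs by (simp add: tree_ordering_def block_cutpoint_graph_def)

lemma cut_vertex_less: "cut_vertex G v \<Longrightarrow> v < n"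
  using verts by (auto simp: cut_vertex_def)

lemma adjacent_code:
  assumes "x \<in> set xs" "y \<in> set xs"
  shows "(x, y) \<in> parcs (block_cutpoint_graph G) \<longleftrightarrow>
    code x < n \<and> n \<le> code y \<and> code x \<in> set (B ! (code y - n)) \<or>
    code y < n \<and> n \<le> code x \<and> code y \<in> set (B ! (code x - n))"
proof -
  consider v w where "x = Inl v" "cut_vertex G v" "y = Inl w" "cut_vertex G w"
    | v S where "x = Inl v" "cut_vertex G v" "y = Inr S" "S \<in> blocks G"
    | v S where "x = Inr S" "S \<in> blocks G" "y = Inl v" "cut_vertex G v"
    | S T where "x = Inr S" "S \<in> blocks G" "y = Inr T" "T \<in> blocks G"
    using assms unfolding items by blast
  then show ?thesis
  proof cases
    case (1 v w)
    then show ?thesis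
      using cut_vertex_less[of v] cut_vertex_less[of w] by (auto simp: block_cutpoint_graph_def)
  next
    case (2 v S)
    obtain i where i: "set (B ! i) = S" "code (Inr S) = n + i"
      using block_index[OF 2(4)] by blast
    then show ?thesis
      using 2 cut_vertex_less[of v] by (auto simp: block_cutpoint_graph_def simp del: bc_code.simps(2))
  next
    case (3 v S)
    obtain i where i: "set (B ! i) = S" "code (Inr S) = n + i"
      using block_index[OF 3(2)] by blast
    then show ?thesis
      using 3 cut_vertex_less[of v] by (auto simp: block_cutpoint_graph_def simp del: bc_code.simps(2))
  next
    case 4
    then show ?thesis by (auto simp: block_cutpoint_graph_def)
  qed
qed

lemma distinct_code: "distinct (map code xs)"
proof -
  have "inj_on code (set xs)"
  proof (rule inj_onI)
    fix x y assume xy: "x \<in> set xs" "y \<in> set xs" "code x = code y"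
    show "x = y"
    proof (cases x)
      case (Inl v)
      with xy have "v < n" using cut_vertex_less by (auto simp: items)
      with Inl xy show ?thesis by (cases y) auto
    next
      case (Inr S)
      with xy have "S \<in> blocks G" by (auto simp: items)
      then obtain i where i: "set (B ! i) = S" "code (Inr S) = n + i" by (rule block_index)
      show ?thesis
      proof (cases y)
        case (Inl v)
        with xy have "v < n" using cut_vertex_less by (auto simp: items)
        with Inl Inr xy i show ?thesis by simp
      next
        case y: (Inr T)
        with xy have "T \<in> blocks G" by (auto simp: items)
        then obtain j where "set (B ! j) = T" "code (Inr T) = n + j" by (rule block_index)
        with i xy(3) Inr y show ?thesis by simp
      qed
    qed
  qed
  then show ?thesis using xs by (simp add: distinct_map tree_ordering_def)
qed

text \<open>Vertices shared by two blocks are cut-vertices and hence items, and rows have at least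
  two entries because no block is a singleton. The rest is the tree ordering, transported by the
  injective coding.\<close>

lemma block_order: "block_order n B (map code xs)"
proof
  show "distinct (B ! i) \<and> set (B ! i) \<subseteq> {..<n} \<and> 2 \<le> length (B ! i)" if "i < length B" for i
  proof -
    have d: "distinct (B ! i)" using B that by (simp add: block_lists_def)
    have "set (B ! i) \<subseteq> {..<n}" "set (B ! i) \<noteq> {}"
      using block_nth[OF that] verts by (auto simp: G.blocks_iff G.biconnected_def)
    moreover have "set (B ! i) \<noteq> {v}" for v
      using G.block_not_singleton[OF connected _ block_nth[OF that]] verts n by simp
    then have "card (set (B ! i)) \<noteq> 1" by (auto simp: card_1_singleton_iff)
    moreover have "card (set (B ! i)) \<noteq> 0" using calculation(2) by simp
    ultimately have "2 \<le> card (set (B ! i))" by linarith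
    then show ?thesis using d \<open>set (B ! i) \<subseteq> {..<n}\<close> by (simp add: distinct_card)
  qed
  show "\<exists>i<length B. v \<in> set (B ! i)" if v: "v < n" for v
  proof -
    obtain S where S: "S \<in> blocks G" "v \<in> S" using G.vertex_in_block[of v] verts v by auto
    then show ?thesis by (metis block_index)
  qed
  show "v \<in> set (map code xs)" if "i < length B" "j < length B" "i \<noteq> j" "v \<in> set (B ! i)" "v \<in> set (B ! j)"
    for i j v
  proof -
    have "set (B ! i) \<noteq> set (B ! j)"
      using B that nth_eq_iff_index_eq[of "map set B" i j] by (auto simp: block_lists_def)
    then have "cut_vertex G v"
      using G.cut_vertex_if_two_blocks[OF connected block_graph] block_nth that by blast
    then have "Inl v \<in> set xs" by (simp add: items)
    then have "code (Inl v) \<in> code ` set xs" by (rule imageI)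
    then show ?thesis by simp
  qed
  show "distinct (map code xs)" by (rule distinct_code)
  show "{y \<in> set (map code xs). n \<le> y} = {n..<n + length B}"
  proof (intro equalityI subsetI)
    fix y assume "y \<in> {y \<in> set (map code xs). n \<le> y}"
    then obtain x where x: "x \<in> set xs" "y = code x" "n \<le> code x" by auto
    show "y \<in> {n..<n + length B}"
    proof (cases x)
      case (Inl v)
      then have "v < n" using x(1) cut_vertex_less by (auto simp: items)
      with Inl x show ?thesis by simp
    next
      case (Inr S)
      then have "S \<in> blocks G" using x(1) by (auto simp: items)
      then obtain i where "i < length B" "code (Inr S) = n + i" by (rule block_index)
      with Inr x show ?thesis by simp
    qed
  next
    fix y assume "y \<in> {n..<n + length B}"
    then have y: "n \<le> y" "y - n < length B" by auto
    have "code (Inr (set (B ! (y - n)))) = y"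
      using bc_code_block[of B "y - n" n] B y by (simp add: block_lists_def)
    moreover have "Inr (set (B ! (y - n))) \<in> set xs" using block_nth[OF y(2)] by (simp add: items)
    ultimately have "y \<in> code ` set xs" by (metis imageI)
    then show "y \<in> {y \<in> set (map code xs). n \<le> y}" using y by simp
  qed
  show "\<exists>!j. i < j \<and> j < length (map code xs) \<and>
      (map code xs ! i < n \<and> n \<le> map code xs ! j \<and> map code xs ! i \<in> set (B ! (map code xs ! j - n)) \<or>
       map code xs ! j < n \<and> n \<le> map code xs ! i \<and> map code xs ! j \<in> set (B ! (map code xs ! i - n)))"
    if i: "Suc i < length (map code xs)" for i
  proof -
    have "\<exists>!j. i < j \<and> j < length xs \<and> (xs ! i, xs ! j) \<in> parcs (block_cutpoint_graph G)"
      using xs i by (simp add: tree_ordering_def)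
    moreover have "(i < j \<and> j < length xs \<and> (xs ! i, xs ! j) \<in> parcs (block_cutpoint_graph G)) \<longleftrightarrow>
      (i < j \<and> j < length (map code xs) \<and>
      (map code xs ! i < n \<and> n \<le> map code xs ! j \<and> map code xs ! i \<in> set (B ! (map code xs ! j - n)) \<or>
       map code xs ! j < n \<and> n \<le> map code xs ! i \<and> map code xs ! j \<in> set (B ! (map code xs ! i - n))))" for j
      using adjacent_code[of "xs ! i" "xs ! j"] by (auto simp del: bc_code.simps)
    ultimately show ?thesis by (simp only:)
  qed
  show "0 < n" using n by simp
qed

text \<open>The eliminated rows are exactly the blocks, and in a block graph the neighbours of
  \<open>v\<close> are the other vertices of the blocks containing \<open>v\<close>. So
  \<open>received\<close> is the sum over the neighbourhood.\<close>

lemma opt_elim_steps: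
  "opt {..<n} (elim_steps n B (map code xs)) init_cost = roman2_domination_number G"
proof -
  interpret block_order n B "map code xs" by (rule block_order)
  let ?es = "elim_steps n B (map code xs)"
  have "block_of ` set ?es = (\<lambda>y. set (B ! (y - n))) ` {n..<n + length B}"
    using block_of_elim_steps[OF order_refl] blocks_ys by simp
  also have "\<dots> = set ` set B"
  proof -
    have "(\<lambda>y. y - n) ` {n..<n + length B} = {..<length B}"
      by (force intro: image_eqI[of _ _ "_ + n"])
    then have "(\<lambda>y. set (B ! (y - n))) ` {n..<n + length B} = (\<lambda>i. set (B ! i)) ` {..<length B}"
      by (metis image_image)
    also have "\<dots> = set ` set B" by (auto simp: set_conv_nth)
    finally show ?thesis .
  qed
  finally have blocks: "block_of ` set ?es = blocks G" using blocks_B by simp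
  have "received ?es f v = (\<Sum>u | v \<rightarrow>\<^bsub>G\<^esub> u. f u)" for f v
  proof -
    have "(\<Union>b\<in>{b \<in> set ?es. v \<in> block_of b}. block_of b - {v}) =
        (\<Union>S\<in>{S \<in> block_of ` set ?es. v \<in> S}. S - {v})" by blast
    also have "\<dots> = {u. v \<rightarrow>\<^bsub>G\<^esub> u}"
      unfolding blocks G.block_graph_edge_iff[OF block_graph] by blast
    finally show ?thesis using received_eq_sum[OF elimination_ys, of f v] by simp
  qed
  then show ?thesis using opt_init_cost[of G ?es] verts G.fin_digraph_axioms by simp
qed

lemma runs_initial_state:
  assumes "length L = n"
  shows "runs (n ^ 5) roman2_program (initial_state L B T (map code xs)) (500 * n)
    (\<lambda>(r, m). r 0 = roman2_domination_number G)"
proof -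
  interpret block_order n B "map code xs" by (rule block_order)
  have "length b \<le> n" if b: "b \<in> set B" for b
  proof -
    obtain i where "i < length B" "b = B ! i" using b by (auto simp: in_set_conv_nth)
    then show ?thesis using rows[of i] card_mono[of "{..<n}" "set b"] by (simp add: distinct_card)
  qed
  then have "length (concat B) \<le> length B * n" by (rule length_concat_le)
  also have "\<dots> \<le> n ^ 2" using length_B by (simp add: power2_eq_square)
  also have "\<dots> \<le> n ^ 5" using n by (intro power_increasing) auto
  finally have concat: "length (concat B) \<le> n ^ 5" .
  \<comment> \<open>The exponent 5 comes from here: a constant factor of 16 is at most
    \<open>n ^ 4\<close>, since \<open>n \<ge> 2\<close>.\<close>
  have "4 + 4 * n \<le> 2 ^ 4 * n" using n by simp
  also have "\<dots> \<le> n ^ 4 * n" using n by (intro mult_right_mono power_mono) auto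
  also have "\<dots> = n ^ 5" by (simp add: eval_nat_numeral)
  finally interpret block_run n B "map code xs" "n ^ 5"
    using concat by unfold_locales
  obtain r m where s: "initial_state L B T (map code xs) = (r, m)" by force
  have "input n B (map code xs) r m" "\<forall>v<n. m 12 v = 0"
    using s assms by (auto simp: initial_state_def input_def array_of_def)
  from runs_roman2_program[OF this] show ?thesis
    unfolding s opt_elim_steps .
qed

end

theorem theorem21:
  shows "\<exists>(P :: prog) (c :: nat) (k :: nat).
    \<forall>(n :: nat) (G :: nat pair_pre_digraph) L B T xs.
      pair_graph G \<and> pverts G = {..<n} \<and>
      Digraph_Component.connected (with_proj G) \<and>
      block_graph (with_proj G) \<and> \<not> complete_graph (with_proj G) \<and>
      adjacency_lists G id n L \<and>
      block_lists (with_proj G) B \<and>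
      adjacency_lists (block_cutpoint_graph (with_proj G)) (bc_code n B) (n + length B) T \<and>
      tree_ordering (block_cutpoint_graph (with_proj G)) xs
      \<longrightarrow> (\<exists>t r m.
            exec (n ^ k) P (initial_state L B T (map (bc_code n B) xs)) t (r, m) \<and>
            t \<le> c * n \<and>
            r 0 = roman2_domination_number (with_proj G))"
proof -
  have "\<exists>t r m. exec (n ^ 5) roman2_program (initial_state L B T (map (bc_code n B) xs)) t (r, m) \<and>
      t \<le> 500 * n \<and> r 0 = roman2_domination_number (with_proj G)"
    if "pair_graph G" and verts: "pverts G = {..<n}"
      and connected: "Digraph_Component.connected (with_proj G)"
      and "block_graph (with_proj G)" and not_complete: "\<not> complete_graph (with_proj G)"
      and L: "adjacency_lists G id n L" and "block_lists (with_proj G) B"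
      and "tree_ordering (block_cutpoint_graph (with_proj G)) xs"
    for n and G :: "nat pair_pre_digraph" and L B T xs
  proof -
    interpret pair_graph G by fact
    have graph: "graph (with_proj G)" by unfold_locales
    have "n \<noteq> 0"
      using connected verts by (auto simp: connected_conv)
    \<comment> \<open>For \<open>n = 1\<close> the word bound would be 1, too small for the constant
      2 that the program stores. A one-vertex graph is complete, so this case is excluded.\<close>
    moreover have "n \<noteq> 1"
    proof
      assume "n = 1"
      then have "pverts G = {0}" using verts by auto
      moreover from this have "parcs G = {}"
        using in_arcsD1 in_arcsD2 pair_no_loops by fastforce
      ultimately have "complete_graph (with_proj G)"
        unfolding complete_graph_def complete_digraph_pair_def by auto
      with not_complete show False ..
    qed
    ultimately have "2 \<le> n" by simp
    interpret tree_ordered_block_graph "with_proj G" n B xs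
      using that graph \<open>2 \<le> n\<close>
      by (simp add: tree_ordered_block_graph_def tree_ordered_block_graph_axioms_def)
    have "length L = n" using L by (simp add: adjacency_lists_def)
    from runs_initial_state[OF this, of T] show ?thesis
      unfolding runs_def by auto
  qed
  then show ?thesis by blast
qed

end
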